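(* Let $K$ be a field of characteristic $0$ equipped with a non-trivial involution $\overline{(-)}$ (a field automorphism with $\overline{\overline{k}}=k$ for all $k\in K$, different from the identity). Let $\Sigma$ be a dagger signature and let $\mathbf{Dot}(\Sigma)$ be the dagger-hypergraph category of dot-diagrams over $\Sigma$. Let $F$ and $G$ be two dot-diagrams over $\Sigma$ with the same domain and codomain. Then $F$ and $G$ are isomorphic if and only if for all dagger-hypergraph functors $\llbracket-\rrbracket:\mathbf{Dot}(\Sigma)\to\mathbf{Mat}(K)$ one has $\llbracket F\rrbracket=\llbracket G\rrbracket$.
   Context: **Dagger signature.** A dagger signature $\Sigma$ consists of a set $\mathrm{Obj}$, a set $\mathrm{Mor}$, functions $\mathrm{dom},\mathrm{cod}:\mathrm{Mor}\to\mathrm{Obj}^*$ (finite words), and a function $\dagger:\mathrm{Mor}\to\mathrm{Mor}$ with $f^{\dagger\dagger}=f$, $\mathrm{dom}(f^\dagger)=\mathrm{cod}(f)$, $\mathrm{cod}(f^\dagger)=\mathrm{dom}(f)$. For a word $w$, $|w|$ is its length and $w[i]$ its $i$-th letter. **Dagger-SCFA.** A dagger-symmetric monoidal category is a symmetric monoidal category $\mathcal C$ with an identity-on-objects monoidal functor $(-)^\dagger:\mathcal C\to\mathcal C^{\mathrm{op}}$ that is involutive and for which the associativity, unit and symmetry isomorphisms satisfy $\alpha^{-1}=\alpha^\dagger$, $\lambda^{-1}=\lambda^\dagger$, $\gamma^{-1}=\gamma^\dagger$. A special commutative Frobenius algebra (SCFA) on $A$ is a tuple $(A,\mu:A\otimes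 A\to A,\eta:I\to A,\delta:A\to A\otimes A,\epsilon:A\to I)$ such that $(\mu,\eta)$ is a commutative monoid, $(\delta,\epsilon)$ is a cocommutative comonoid, $(1_A\otimes\mu)\circ(\delta\otimes 1_A)=\delta\circ\mu$, and $\mu\circ\delta=1_A$. A dagger-SCFA additionally satisfies $\mu^\dagger=\delta$, $\eta^\dagger=\epsilon$. **Dagger-hypergraph category.** A dagger-symmetric monoidal category in which every object is equipped with a chosen dagger-SCFA, such that the one chosen on $A\otimes B$ is the product of those on $A$ and $B$ (so $\mu_{A\otimes B}=(\mu_A\otimes\mu_B)\circ(1_A\otimes\gamma_{B,A}\otimes 1_B)$, $\eta_{A\otimes B}=\eta_A\otimes\eta_B$, and dually for $\delta,\epsilon$). **Dagger-hypergraph functor.** A strong symmetric monoidal functor $F$ with natural isomorphisms $p_{A,B}:F(A\otimes B)\to FA\otimes FB$ and an isomorphism $u:FI\to I$ (satisfying the usual associativity, unit and symmetry coherence conditions) such that $F(f^\dagger)=(Ff)^\dagger$ for all morphisms $f$, and $F(\mu_A)=\mu_{FA}\circ p_{A,A}$, $F(\eta_A)=\eta_{FA}\circ u$, $p_{A,A}\circ F(\delta_A)=\delta_{FA}$, $u\circ F(\epsilon_A)=\epsilon_{FA}$. **Dot-diagrams.** A dot-diagram $F$ over $\Sigma$ consists of: a finite set $B^F$ (boxes), a finite set $D^F$ (dots), sets $I^F=\{\mathrm{in}_1,\dots,\mathrm{in}_m\}$ and $O^F=\{\mathrm{out}_1,\dots,\mathrm{out}_n\}$ (diagram inputs and outputs),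 labelling functions $\ell_b^F:B^F\to\mathrm{Mor}$ and $\ell_d^F:D^F\to\mathrm{Obj}$, and wiring functions $\theta_{\mathrm{in}}^F:\mathrm{Inputs}^F\to D^F$, $\theta_{\mathrm{out}}^F:\mathrm{Outputs}^F\to D^F$, where $\mathrm{Inputs}^F=\{(b,i): b\in B^F, 1\le i\le|\mathrm{dom}(\ell_b^F(b))|\}+I^F$ and $\mathrm{Outputs}^F=\{(j,b): b\in B^F, 1\le j\le|\mathrm{cod}(\ell_b^F(b))|\}+O^F$, subject to $\ell_d^F(\theta_{\mathrm{in}}^F(b,i))=\mathrm{dom}(\ell_b^F(b))[i]$ and $\ell_d^F(\theta_{\mathrm{out}}^F(j,b))=\mathrm{cod}(\ell_b^F(b))[j]$. Its domain is the word with $i$-th letter $\ell_d^F(\theta_{\mathrm{in}}^F(\mathrm{in}_i))$ and its codomain the word with $j$-th letter $\ell_d^F(\theta_{\mathrm{out}}^F(\mathrm{out}_j))$. A homomorphism $\Phi:F\to G$ of dot-diagrams with $I^F=I^G$, $O^F=O^G$ is a pair of functions $\Phi_b:B^F\to B^G$, $\Phi_d:D^F\to D^G$ with $\ell_b^G(\Phi_b(b))=\ell_b^F(b)$, $\ell_d^G(\Phi_d(d))=\ell_d^F(d)$, $\theta_{\mathrm{in}}^G(\Phi_b(b),i)=\Phi_d(\theta_{\mathrm{in}}^F(b,i))$, $\theta_{\mathrm{out}}^G(j,\Phi_b(b))=\Phi_d(\theta_{\mathrm{out}}^F(j,b))$, $\theta_{\mathrm{in}}^G(\mathrm{in}_i)=\Phi_d(\theta_{\mathrm{in}}^F(\mathrm{in}_i))$,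 $\theta_{\mathrm{out}}^G(\mathrm{out}_j)=\Phi_d(\theta_{\mathrm{out}}^F(\mathrm{out}_j))$. An isomorphism is an invertible homomorphism. **The category $\mathbf{Dot}(\Sigma)$.** Objects are words in $\mathrm{Obj}^*$. Morphisms $v\to w$ are isomorphism classes of dot-diagrams with domain $v$ and codomain $w$; for a dot-diagram $F$, $\llbracket F\rrbracket$ means the image of its class. The composite $G\circ F$ has boxes $B^F+B^G$, inputs $I^F$, outputs $O^G$, and dots the pushout of $D^F\xleftarrow{\theta_{\mathrm{out}}^F}O^F\cong I^G\xrightarrow{\theta_{\mathrm{in}}^G}D^G$ in sets, with induced labellings and with wiring obtained by composing $\theta^F+\theta^G$ with the quotient map $D^F+D^G\to D^{G\circ F}$. The monoidal product is concatenation of words and disjoint union of diagrams (the inputs/outputs of the second diagram placed after those of the first); the unit object $I$ is the empty word. Identities and swaps have no boxes and one dot per letter, with each dot connected to the evident input and output. For a letter $A$, $\mu_A,\eta_A,\delta_A,\epsilon_A$ are the box-free diagrams with a single dot labelled $A$ connected to respectively $2,0,1,1$ diagram inputs and $1,1,2,0$ diagram outputs; on words the SCFA is the product one. The dagger $F^\dagger$ has the same boxes and dots, each box label $f$ replaced by $f^\dagger$, and the roles of inputs and outputs (hence $\theta_{\mathrm{in}}$ and $\theta_{\mathrm{out}}$) interchanged. **The category $\mathbf{Mat}(K)$.** Objects are finite sets; a morphism $\psi:\mathcal I\to\mathcal J$ is a family $(\psi_i^j)_{i\in\mathcal I,j\in\mathcal J}$ of elements of $K$; $(g\circ f)_i^k=\sum_j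 f_i^jg_j^k$, identities are Kronecker deltas. The monoidal product is $\mathcal I\otimes\mathcal J=\mathcal I\times\mathcal J$ with $(\psi\otimes\phi)_{(i,j)}^{(k,l)}=\psi_i^k\phi_j^l$, the unit is a one-element set, and the structural isomorphisms are the evident permutation matrices. The dagger is $(\psi^\dagger)_i^j=\overline{\psi_j^i}$. The dagger-SCFA on $\mathcal I$ is: $\mu_{ij}^k=1$ if $i=j=k$ and $0$ otherwise; $\delta_i^{jk}=1$ if $i=j=k$ and $0$ otherwise; $\eta^i=1$; $\epsilon_i=1$. *)

theory Defs
  imports Complex_Main
begin

section \<open>Dagger signatures and dot-diagrams\<close>

record ('o, 'm) signature =
  Obj :: "'o set"
  Mor :: "'m set"
  sdom :: "'m \<Rightarrow> 'o list"
  scod :: "'m \<Rightarrow> 'o list"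
  sdag :: "'m \<Rightarrow> 'm"

locale dagger_signature =
  fixes S :: "('o, 'm) signature"
  assumes sdom: "f \<in> Mor S \<Longrightarrow> sdom S f \<in> lists (Obj S)"
    and scod: "f \<in> Mor S \<Longrightarrow> scod S f \<in> lists (Obj S)"
    and sdag: "f \<in> Mor S \<Longrightarrow> sdag S f \<in> Mor S"
    and sdag_sdag: "f \<in> Mor S \<Longrightarrow> sdag S (sdag S f) = f"
    and sdom_sdag: "f \<in> Mor S \<Longrightarrow> sdom S (sdag S f) = scod S f"
    and scod_sdag: "f \<in> Mor S \<Longrightarrow> scod S (sdag S f) = sdom S f"

text \<open>
  All positions in words and all diagram inputs and outputs are counted from 0.
  \<open>Box b i\<close> is the \<open>i\<close>-th input (or output) of the box \<open>b\<close>; \<open>Ext i\<close> is the \<open>i\<close>-th input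
  (or output) of the whole diagram.
\<close>

datatype 'b port = Box 'b nat | Ext nat

record ('o, 'm, 'b, 'd) diagram =
  boxes :: "'b set"
  dots :: "'d set"
  n_in :: nat
  n_out :: nat
  blab :: "'b \<Rightarrow> 'm"
  dlab :: "'d \<Rightarrow> 'o"
  win :: "'b port \<Rightarrow> 'd"
  wout :: "'b port \<Rightarrow> 'd"

definition inputs :: "('o, 'm) signature \<Rightarrow> ('o, 'm, 'b, 'd) diagram \<Rightarrow> 'b port set" where
  "inputs S F =
     {Box b i | b i. b \<in> boxes F \<and> i < length (sdom S (blab F b))} \<union> Ext ` {..<n_in F}"

definition outputs :: "('o, 'm) signature \<Rightarrow> ('o, 'm, 'b, 'd) diagram \<Rightarrow> 'b port set" where
  "outputs S F =
     {Box b j | b j. b \<in> boxes F \<and> j < length (scod S (blab F b))} \<union> Ext ` {..<n_out F}"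

locale dot_diagram =
  fixes S :: "('o, 'm) signature" and F :: "('o, 'm, 'b, 'd) diagram"
  assumes finite_boxes: "finite (boxes F)"
    and finite_dots: "finite (dots F)"
    and blab: "b \<in> boxes F \<Longrightarrow> blab F b \<in> Mor S"
    and dlab: "d \<in> dots F \<Longrightarrow> dlab F d \<in> Obj S"
    and win: "x \<in> inputs S F \<Longrightarrow> win F x \<in> dots F"
    and wout: "x \<in> outputs S F \<Longrightarrow> wout F x \<in> dots F"
    and dlab_win:
      "b \<in> boxes F \<Longrightarrow> i < length (sdom S (blab F b)) \<Longrightarrow>
        dlab F (win F (Box b i)) = sdom S (blab F b) ! i"
    and dlab_wout:
      "b \<in> boxes F \<Longrightarrow> j < length (scod S (blab F b)) \<Longrightarrow>
        dlab F (wout F (Box b j)) = scod S (blab F b) ! j"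

definition diag_dom :: "('o, 'm, 'b, 'd) diagram \<Rightarrow> 'o list" where
  "diag_dom F = map (\<lambda>i. dlab F (win F (Ext i))) [0..<n_in F]"

definition diag_cod :: "('o, 'm, 'b, 'd) diagram \<Rightarrow> 'o list" where
  "diag_cod F = map (\<lambda>j. dlab F (wout F (Ext j))) [0..<n_out F]"

locale diagram_hom =
  fixes S :: "('o, 'm) signature"
    and F :: "('o, 'm, 'b, 'd) diagram" and G :: "('o, 'm, 'c, 'e) diagram"
    and \<phi>b :: "'b \<Rightarrow> 'c" and \<phi>d :: "'d \<Rightarrow> 'e"
  assumes n_in: "n_in F = n_in G"
    and n_out: "n_out F = n_out G"
    and boxes: "b \<in> boxes F \<Longrightarrow> \<phi>b b \<in> boxes G"
    and dots: "d \<in> dots F \<Longrightarrow> \<phi>d d \<in> dots G"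
    and blab: "b \<in> boxes F \<Longrightarrow> blab G (\<phi>b b) = blab F b"
    and dlab: "d \<in> dots F \<Longrightarrow> dlab G (\<phi>d d) = dlab F d"
    and win_Box:
      "b \<in> boxes F \<Longrightarrow> i < length (sdom S (blab F b)) \<Longrightarrow>
        win G (Box (\<phi>b b) i) = \<phi>d (win F (Box b i))"
    and wout_Box:
      "b \<in> boxes F \<Longrightarrow> j < length (scod S (blab F b)) \<Longrightarrow>
        wout G (Box (\<phi>b b) j) = \<phi>d (wout F (Box b j))"
    and win_Ext: "i < n_in F \<Longrightarrow> win G (Ext i) = \<phi>d (win F (Ext i))"
    and wout_Ext: "j < n_out F \<Longrightarrow> wout G (Ext j) = \<phi>d (wout F (Ext j))"

definition diagram_iso ::
  "('o, 'm) signature \<Rightarrow> ('o, 'm, 'b, 'd) diagram \<Rightarrow> ('o, 'm, 'c, 'e) diagram \<Rightarrow> bool" where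
  "diagram_iso S F G \<longleftrightarrow>
     (\<exists>\<phi>b \<phi>d \<psi>b \<psi>d. diagram_hom S F G \<phi>b \<phi>d \<and> diagram_hom S G F \<psi>b \<psi>d \<and>
        (\<forall>b\<in>boxes F. \<psi>b (\<phi>b b) = b) \<and> (\<forall>d\<in>dots F. \<psi>d (\<phi>d d) = d) \<and>
        (\<forall>b\<in>boxes G. \<phi>b (\<psi>b b) = b) \<and> (\<forall>d\<in>dots G. \<phi>d (\<psi>d d) = d))"


section \<open>Operations on dot-diagrams\<close>

definition glue ::
  "('o, 'm, 'c, 'e) diagram \<Rightarrow> ('o, 'm, 'b, 'd) diagram \<Rightarrow> (('d + 'e) \<times> ('d + 'e)) set" where
  "glue G F = {(Inl (wout F (Ext j)), Inr (win G (Ext j))) | j. j < n_out F}"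

text \<open>The quotient map onto the pushout: a dot goes to its class for the equivalence
  relation generated by \<open>glue G F\<close>.\<close>

definition glue_class ::
  "('o, 'm, 'c, 'e) diagram \<Rightarrow> ('o, 'm, 'b, 'd) diagram \<Rightarrow> 'd + 'e \<Rightarrow> ('d + 'e) set" where
  "glue_class G F x = (glue G F \<union> (glue G F)\<inverse>)\<^sup>* `` {x}"

text \<open>\<open>diag_comp G F\<close> is the composite of \<open>F\<close> followed by \<open>G\<close>; it is meaningful when
  \<open>diag_cod F = diag_dom G\<close>, and then all members of a class of dots have the same label.\<close>

definition diag_comp ::
  "('o, 'm, 'c, 'e) diagram \<Rightarrow> ('o, 'm, 'b, 'd) diagram \<Rightarrow>
    ('o, 'm, 'b + 'c, ('d + 'e) set) diagram" where
  "diag_comp G F =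
    \<lparr>boxes = boxes F <+> boxes G,
     dots = glue_class G F ` (dots F <+> dots G),
     n_in = n_in F,
     n_out = n_out G,
     blab = case_sum (blab F) (blab G),
     dlab = (\<lambda>c. the_elem (case_sum (dlab F) (dlab G) ` c)),
     win = (\<lambda>x. glue_class G F (case x of
         Box (Inl b) i \<Rightarrow> Inl (win F (Box b i))
       | Box (Inr b) i \<Rightarrow> Inr (win G (Box b i))
       | Ext i \<Rightarrow> Inl (win F (Ext i)))),
     wout = (\<lambda>x. glue_class G F (case x of
         Box (Inl b) j \<Rightarrow> Inl (wout F (Box b j))
       | Box (Inr b) j \<Rightarrow> Inr (wout G (Box b j))
       | Ext j \<Rightarrow> Inr (wout G (Ext j))))\<rparr>"

definition diag_tensor ::
  "('o, 'm, 'b, 'd) diagram \<Rightarrow> ('o, 'm, 'c, 'e) diagram \<Rightarrow>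
    ('o, 'm, 'b + 'c, 'd + 'e) diagram" where
  "diag_tensor F G =
    \<lparr>boxes = boxes F <+> boxes G,
     dots = dots F <+> dots G,
     n_in = n_in F + n_in G,
     n_out = n_out F + n_out G,
     blab = case_sum (blab F) (blab G),
     dlab = case_sum (dlab F) (dlab G),
     win = (\<lambda>x. case x of
         Box (Inl b) i \<Rightarrow> Inl (win F (Box b i))
       | Box (Inr b) i \<Rightarrow> Inr (win G (Box b i))
       | Ext i \<Rightarrow> if i < n_in F then Inl (win F (Ext i)) else Inr (win G (Ext (i - n_in F)))),
     wout = (\<lambda>x. case x of
         Box (Inl b) j \<Rightarrow> Inl (wout F (Box b j))
       | Box (Inr b) j \<Rightarrow> Inr (wout G (Box b j))
       | Ext j \<Rightarrow> if j < n_out F then Inl (wout F (Ext j)) else Inr (wout G (Ext (j - n_out F))))\<rparr>"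

definition diag_dag ::
  "('o, 'm) signature \<Rightarrow> ('o, 'm, 'b, 'd) diagram \<Rightarrow> ('o, 'm, 'b, 'd) diagram" where
  "diag_dag S F =
    \<lparr>boxes = boxes F, dots = dots F, n_in = n_out F, n_out = n_in F,
     blab = (\<lambda>b. sdag S (blab F b)), dlab = dlab F, win = wout F, wout = win F\<rparr>"

text \<open>The box-free diagram with one dot per letter of \<open>w\<close>, \<open>m\<close> inputs and \<open>n\<close> outputs, whose
  \<open>i\<close>-th input and \<open>j\<close>-th output are attached to the dots \<open>f i\<close> and \<open>g j\<close>.\<close>

definition box_free ::
  "'o list \<Rightarrow> nat \<Rightarrow> nat \<Rightarrow> (nat \<Rightarrow> nat) \<Rightarrow> (nat \<Rightarrow> nat) \<Rightarrow> ('o, 'm, nat, nat) diagram" where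
  "box_free w m n f g =
    \<lparr>boxes = {}, dots = {..<length w}, n_in = m, n_out = n,
     blab = (\<lambda>_. undefined), dlab = (\<lambda>i. w ! i),
     win = (\<lambda>x. case x of Box _ _ \<Rightarrow> undefined | Ext i \<Rightarrow> f i),
     wout = (\<lambda>x. case x of Box _ _ \<Rightarrow> undefined | Ext j \<Rightarrow> g j)\<rparr>"

definition diag_id :: "'o list \<Rightarrow> ('o, 'm, nat, nat) diagram" where
  "diag_id w = box_free w (length w) (length w) (\<lambda>i. i) (\<lambda>j. j)"

definition diag_swap :: "'o list \<Rightarrow> 'o list \<Rightarrow> ('o, 'm, nat, nat) diagram" where
  "diag_swap v w = box_free (v @ w) (length v + length w) (length w + length v)
     (\<lambda>i. i) (\<lambda>j. if j < length w then length v + j else j - length w)"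

text \<open>The spider with \<open>m\<close> inputs and \<open>n\<close> outputs on a single letter.\<close>

definition diag_spider :: "'o \<Rightarrow> nat \<Rightarrow> nat \<Rightarrow> ('o, 'm, nat, nat) diagram" where
  "diag_spider a m n = box_free [a] m n (\<lambda>_. 0) (\<lambda>_. 0)"


section \<open>Dagger-hypergraph categories and functors\<close>

text \<open>The data of a dagger-hypergraph category. \<open>Comp C g f\<close> is \<open>f\<close> followed by \<open>g\<close>.\<close>

record ('a, 'f) hypergraph_data =
  Ob :: "'a set"
  Hom :: "'a \<Rightarrow> 'a \<Rightarrow> 'f set"
  Id :: "'a \<Rightarrow> 'f"
  Comp :: "'f \<Rightarrow> 'f \<Rightarrow> 'f"
  TensorO :: "'a \<Rightarrow> 'a \<Rightarrow> 'a"
  TensorM :: "'f \<Rightarrow> 'f \<Rightarrow> 'f"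
  Unit :: 'a
  Assoc :: "'a \<Rightarrow> 'a \<Rightarrow> 'a \<Rightarrow> 'f"   \<comment> \<open>\<open>(A \<otimes> B) \<otimes> C \<rightarrow> A \<otimes> (B \<otimes> C)\<close>\<close>
  LUnit :: "'a \<Rightarrow> 'f"              \<comment> \<open>\<open>I \<otimes> A \<rightarrow> A\<close>\<close>
  RUnit :: "'a \<Rightarrow> 'f"              \<comment> \<open>\<open>A \<otimes> I \<rightarrow> A\<close>\<close>
  Swap :: "'a \<Rightarrow> 'a \<Rightarrow> 'f"         \<comment> \<open>\<open>A \<otimes> B \<rightarrow> B \<otimes> A\<close>\<close>
  Dag :: "'f \<Rightarrow> 'f"
  Mu :: "'a \<Rightarrow> 'f"
  Eta :: "'a \<Rightarrow> 'f"
  Delta :: "'a \<Rightarrow> 'f"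
  Eps :: "'a \<Rightarrow> 'f"

definition is_iso :: "('a, 'f) hypergraph_data \<Rightarrow> 'a \<Rightarrow> 'a \<Rightarrow> 'f \<Rightarrow> bool" where
  "is_iso C A B f \<longleftrightarrow>
     f \<in> Hom C A B \<and> (\<exists>g\<in>Hom C B A. Comp C g f = Id C A \<and> Comp C f g = Id C B)"

text \<open>A functor includes its comparison morphisms \<open>FP H A B : F(A \<otimes> B) \<rightarrow> FA \<otimes> FB\<close> and
  \<open>FU H : FI \<rightarrow> I\<close>.\<close>

record ('a, 'f, 'b, 'g) functor_data =
  FO :: "'a \<Rightarrow> 'b"
  FM :: "'f \<Rightarrow> 'g"
  FP :: "'a \<Rightarrow> 'a \<Rightarrow> 'g"
  FU :: 'g

locale dagger_hypergraph_functor =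
  fixes C :: "('a, 'f) hypergraph_data" and D :: "('b, 'g) hypergraph_data"
    and H :: "('a, 'f, 'b, 'g) functor_data"
  assumes FO_Ob: "A \<in> Ob C \<Longrightarrow> FO H A \<in> Ob D"
    and FM_Hom: "\<lbrakk>A \<in> Ob C; B \<in> Ob C; f \<in> Hom C A B\<rbrakk> \<Longrightarrow> FM H f \<in> Hom D (FO H A) (FO H B)"
    and FM_Id: "A \<in> Ob C \<Longrightarrow> FM H (Id C A) = Id D (FO H A)"
    and FM_Comp:
      "\<lbrakk>A \<in> Ob C; B \<in> Ob C; E \<in> Ob C; f \<in> Hom C A B; g \<in> Hom C B E\<rbrakk> \<Longrightarrow>
        FM H (Comp C g f) = Comp D (FM H g) (FM H f)"
    and FP_iso:
      "\<lbrakk>A \<in> Ob C; B \<in> Ob C\<rbrakk> \<Longrightarrow>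
        is_iso D (FO H (TensorO C A B)) (TensorO D (FO H A) (FO H B)) (FP H A B)"
    and FU_iso: "is_iso D (FO H (Unit C)) (Unit D) (FU H)"
    and FP_natural:
      "\<lbrakk>A \<in> Ob C; A' \<in> Ob C; B \<in> Ob C; B' \<in> Ob C; f \<in> Hom C A A'; g \<in> Hom C B B'\<rbrakk> \<Longrightarrow>
        Comp D (TensorM D (FM H f) (FM H g)) (FP H A B)
        = Comp D (FP H A' B') (FM H (TensorM C f g))"
    and FP_assoc:
      "\<lbrakk>A \<in> Ob C; B \<in> Ob C; E \<in> Ob C\<rbrakk> \<Longrightarrow>
        Comp D (Assoc D (FO H A) (FO H B) (FO H E))
          (Comp D (TensorM D (FP H A B) (Id D (FO H E))) (FP H (TensorO C A B) E))
        = Comp D (TensorM D (Id D (FO H A)) (FP H B E))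
            (Comp D (FP H A (TensorO C B E)) (FM H (Assoc C A B E)))"
    and FP_lunit:
      "A \<in> Ob C \<Longrightarrow>
        Comp D (LUnit D (FO H A)) (Comp D (TensorM D (FU H) (Id D (FO H A))) (FP H (Unit C) A))
        = FM H (LUnit C A)"
    and FP_runit:
      "A \<in> Ob C \<Longrightarrow>
        Comp D (RUnit D (FO H A)) (Comp D (TensorM D (Id D (FO H A)) (FU H)) (FP H A (Unit C)))
        = FM H (RUnit C A)"
    and FP_swap:
      "\<lbrakk>A \<in> Ob C; B \<in> Ob C\<rbrakk> \<Longrightarrow>
        Comp D (Swap D (FO H A) (FO H B)) (FP H A B) = Comp D (FP H B A) (FM H (Swap C A B))"
    and FM_Dag:
      "\<lbrakk>A \<in> Ob C; B \<in> Ob C; f \<in> Hom C A B\<rbrakk> \<Longrightarrow> FM H (Dag C f) = Dag D (FM H f)"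
    and FM_Mu: "A \<in> Ob C \<Longrightarrow> FM H (Mu C A) = Comp D (Mu D (FO H A)) (FP H A A)"
    and FM_Eta: "A \<in> Ob C \<Longrightarrow> FM H (Eta C A) = Comp D (Eta D (FO H A)) (FU H)"
    and FM_Delta: "A \<in> Ob C \<Longrightarrow> Comp D (FP H A A) (FM H (Delta C A)) = Delta D (FO H A)"
    and FM_Eps: "A \<in> Ob C \<Longrightarrow> Comp D (FU H) (FM H (Eps C A)) = Eps D (FO H A)"


section \<open>The category of dot-diagrams\<close>

text \<open>
  A morphism is an isomorphism class of dot-diagrams. Since boxes and dots form finite sets,
  every diagram is isomorphic to one whose boxes and dots are natural numbers, and a class is
  represented by the set of its members of that form. \<open>dcls S F\<close> is thus the class of a
  diagram \<open>F\<close> whose boxes and dots may be taken from any types.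
\<close>

type_synonym ('o, 'm) dot_class = "('o, 'm, nat, nat) diagram set"

definition dcls :: "('o, 'm) signature \<Rightarrow> ('o, 'm, 'b, 'd) diagram \<Rightarrow> ('o, 'm) dot_class" where
  "dcls S F = {F'. dot_diagram S F' \<and> diagram_iso S F' F}"

text \<open>In the following three operations the union runs over all choices of representatives;
  the class united over does not depend on the choice.\<close>

definition dot_comp ::
  "('o, 'm) signature \<Rightarrow> ('o, 'm) dot_class \<Rightarrow> ('o, 'm) dot_class \<Rightarrow> ('o, 'm) dot_class" where
  "dot_comp S Y X = (\<Union>F\<in>X. \<Union>G\<in>Y. dcls S (diag_comp G F))"

definition dot_tensor ::
  "('o, 'm) signature \<Rightarrow> ('o, 'm) dot_class \<Rightarrow> ('o, 'm) dot_class \<Rightarrow> ('o, 'm) dot_class" where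
  "dot_tensor S X Y = (\<Union>F\<in>X. \<Union>G\<in>Y. dcls S (diag_tensor F G))"

definition dot_dag :: "('o, 'm) signature \<Rightarrow> ('o, 'm) dot_class \<Rightarrow> ('o, 'm) dot_class" where
  "dot_dag S X = (\<Union>F\<in>X. dcls S (diag_dag S F))"

definition dot_id :: "('o, 'm) signature \<Rightarrow> 'o list \<Rightarrow> ('o, 'm) dot_class" where
  "dot_id S w = dcls S (diag_id w)"

definition dot_swap :: "('o, 'm) signature \<Rightarrow> 'o list \<Rightarrow> 'o list \<Rightarrow> ('o, 'm) dot_class" where
  "dot_swap S v w = dcls S (diag_swap v w)"

text \<open>The Frobenius structure of a word is the product of those of its letters.\<close>

primrec dot_mu :: "('o, 'm) signature \<Rightarrow> 'o list \<Rightarrow> ('o, 'm) dot_class" where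
  "dot_mu S [] = dot_id S []"
| "dot_mu S (a # w) =
     dot_comp S (dot_tensor S (dcls S (diag_spider a 2 1)) (dot_mu S w))
       (dot_tensor S (dot_tensor S (dot_id S [a]) (dot_swap S w [a])) (dot_id S w))"

primrec dot_eta :: "('o, 'm) signature \<Rightarrow> 'o list \<Rightarrow> ('o, 'm) dot_class" where
  "dot_eta S [] = dot_id S []"
| "dot_eta S (a # w) = dot_tensor S (dcls S (diag_spider a 0 1)) (dot_eta S w)"

primrec dot_delta :: "('o, 'm) signature \<Rightarrow> 'o list \<Rightarrow> ('o, 'm) dot_class" where
  "dot_delta S [] = dot_id S []"
| "dot_delta S (a # w) =
     dot_comp S (dot_tensor S (dot_tensor S (dot_id S [a]) (dot_swap S [a] w)) (dot_id S w))
       (dot_tensor S (dcls S (diag_spider a 1 2)) (dot_delta S w))"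

primrec dot_eps :: "('o, 'm) signature \<Rightarrow> 'o list \<Rightarrow> ('o, 'm) dot_class" where
  "dot_eps S [] = dot_id S []"
| "dot_eps S (a # w) = dot_tensor S (dcls S (diag_spider a 1 0)) (dot_eps S w)"

definition Dot :: "('o, 'm) signature \<Rightarrow> ('o list, ('o, 'm) dot_class) hypergraph_data" where
  "Dot S =
    \<lparr>Ob = lists (Obj S),
     Hom = (\<lambda>v w. {dcls S F | F :: ('o, 'm, nat, nat) diagram.
               dot_diagram S F \<and> diag_dom F = v \<and> diag_cod F = w}),
     Id = dot_id S,
     Comp = dot_comp S,
     TensorO = (@),
     TensorM = dot_tensor S,
     Unit = [],
     Assoc = (\<lambda>u v w. dot_id S (u @ v @ w)),
     LUnit = dot_id S,
     RUnit = dot_id S,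
     Swap = dot_swap S,
     Dag = dot_dag S,
     Mu = dot_mu S,
     Eta = dot_eta S,
     Delta = dot_delta S,
     Eps = dot_eps S\<rparr>"


section \<open>The category of matrices\<close>

locale nontrivial_involution =
  fixes bar :: "'k::field \<Rightarrow> 'k"
  assumes bar_add: "bar (x + y) = bar x + bar y"
    and bar_mult: "bar (x * y) = bar x * bar y"
    and bar_one: "bar 1 = 1"
    and bar_bar: "bar (bar x) = x"
    and bar_nontrivial: "bar \<noteq> id"

text \<open>
  The objects are the finite sets with elements in \<open>'i elt\<close>, the closure of an arbitrary type
  \<open>'i\<close> of atoms under pairing and a one-element set; this makes the cartesian product an
  operation on objects within a single type.
\<close>

datatype 'i elt = Atom 'i | Star | EPair (pfst: "'i elt") (psnd: "'i elt")

definition pprod :: "'i elt set \<Rightarrow> 'i elt set \<Rightarrow> 'i elt set" where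
  "pprod I J = {EPair i j | i j. i \<in> I \<and> j \<in> J}"

text \<open>A matrix carries its index sets, and its entries are 0 off them, so that equality of
  matrices is equality of families.\<close>

datatype ('i, 'k) matrix =
  Matrix (src: "'i elt set") (tgt: "'i elt set") (entry: "'i elt \<Rightarrow> 'i elt \<Rightarrow> 'k")

definition mat :: "'i elt set \<Rightarrow> 'i elt set \<Rightarrow> ('i elt \<Rightarrow> 'i elt \<Rightarrow> 'k::field) \<Rightarrow> ('i, 'k) matrix" where
  "mat I J f = Matrix I J (\<lambda>i j. if i \<in> I \<and> j \<in> J then f i j else 0)"

text \<open>The matrix of a function from \<open>I\<close> to \<open>J\<close>.\<close>

definition fun_mat ::
  "'i elt set \<Rightarrow> 'i elt set \<Rightarrow> ('i elt \<Rightarrow> 'i elt) \<Rightarrow> ('i, 'k::field) matrix" where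
  "fun_mat I J h = mat I J (\<lambda>i j. of_bool (h i = j))"

definition Mat :: "('k::field \<Rightarrow> 'k) \<Rightarrow> ('i elt set, ('i, 'k) matrix) hypergraph_data" where
  "Mat bar =
    \<lparr>Ob = {I. finite I},
     Hom = (\<lambda>I J. {mat I J f | f. True}),
     Id = (\<lambda>I. mat I I (\<lambda>i j. of_bool (i = j))),
     Comp = (\<lambda>g f. mat (src f) (tgt g) (\<lambda>i k. \<Sum>j\<in>tgt f. entry f i j * entry g j k)),
     TensorO = pprod,
     TensorM = (\<lambda>f g. mat (pprod (src f) (src g)) (pprod (tgt f) (tgt g))
                  (\<lambda>x y. entry f (pfst x) (pfst y) * entry g (psnd x) (psnd y))),
     Unit = {Star},
     Assoc = (\<lambda>I J L. fun_mat (pprod (pprod I J) L) (pprod I (pprod J L))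
                (\<lambda>x. EPair (pfst (pfst x)) (EPair (psnd (pfst x)) (psnd x)))),
     LUnit = (\<lambda>I. fun_mat (pprod {Star} I) I psnd),
     RUnit = (\<lambda>I. fun_mat (pprod I {Star}) I pfst),
     Swap = (\<lambda>I J. fun_mat (pprod I J) (pprod J I) (\<lambda>x. EPair (psnd x) (pfst x))),
     Dag = (\<lambda>f. mat (tgt f) (src f) (\<lambda>j i. bar (entry f i j))),
     Mu = (\<lambda>I. mat (pprod I I) I (\<lambda>x k. of_bool (pfst x = k \<and> psnd x = k))),
     Eta = (\<lambda>I. mat {Star} I (\<lambda>_ _. 1)),
     Delta = (\<lambda>I. mat I (pprod I I) (\<lambda>i y. of_bool (pfst y = i \<and> psnd y = i))),
     Eps = (\<lambda>I. mat I {Star} (\<lambda>_ _. 1))\<rparr>"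

end

theory Submission
  imports Defs "HOL-Library.FuncSet" "HOL-Computational_Algebra.Polynomial"
begin

text \<open>
  Given finite sets \<open>X a\<close> and matrices \<open>M f\<close> with \<open>M (f\<^sup>\<dagger>) = (M f)\<^sup>\<dagger>\<close>, the state sum of a diagram
  (sum over colourings of the dots, product over the boxes) is a dagger-hypergraph functor, so
  diagrams that no functor separates have equal state sums. For a family \<open>N\<close> of matrices over the
  natural numbers, not subject to any dagger condition, and \<open>\<omega> \<noteq> 0\<close> with \<open>bar \<omega> = -\<omega>\<close>, the matrices
  \<open>(r + \<omega>) N f + (r - \<omega>) (N (f\<^sup>\<dagger>))\<^sup>T\<close> form such a model for every natural number \<open>r\<close>. The state sums
  are polynomials in \<open>r\<close>, hence agree also at \<open>r = \<omega>\<close>, where the second term vanishes. Taking for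
  \<open>N\<close> the matrices that count the boxes of a part of a target diagram, one sees that the two diagrams
  have equally many homomorphisms into every part of the target, hence (as in Lovasz's theorem)
  equally many surjective ones onto the target. With each diagram in turn as the target, this gives
  surjective homomorphisms in both directions, and these are isomorphisms because everything is finite.
\<close>

section \<open>Isomorphisms of dot-diagrams\<close>

lemma Box_in_inputs [simp]:
  "Box b i \<in> inputs S F \<longleftrightarrow> b \<in> boxes F \<and> i < length (sdom S (blab F b))"
  and Ext_in_inputs [simp]: "Ext i \<in> inputs S F \<longleftrightarrow> i < n_in F"
  and Box_in_outputs [simp]:
  "Box b i \<in> outputs S F \<longleftrightarrow> b \<in> boxes F \<and> i < length (scod S (blab F b))"
  and Ext_in_outputs [simp]: "Ext i \<in> outputs S F \<longleftrightarrow> i < n_out F"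
  by (auto simp: inputs_def outputs_def)

lemma diagram_hom_comp:
  assumes "dot_diagram S F" "diagram_hom S F G b d" "diagram_hom S G H b' d'"
  shows "diagram_hom S F H (b' \<circ> b) (d' \<circ> d)"
proof -
  interpret F: dot_diagram S F by fact
  interpret FG: diagram_hom S F G b d by fact
  interpret GH: diagram_hom S G H b' d' by fact
  show ?thesis
    by standard
      (auto simp: FG.n_in GH.n_in FG.n_out GH.n_out FG.boxes GH.boxes FG.dots GH.dots FG.blab GH.blab
        FG.dlab GH.dlab FG.win_Box GH.win_Box FG.wout_Box GH.wout_Box
        FG.win_Ext GH.win_Ext FG.wout_Ext GH.wout_Ext)
qed

lemma diagram_iso_sym: "diagram_iso S F G \<Longrightarrow> diagram_iso S G F"
  unfolding diagram_iso_def by blast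

lemma diagram_iso_bijE:
  assumes "diagram_iso S F G"
  obtains b d where "diagram_hom S F G b d" "bij_betw b (boxes F) (boxes G)"
    "bij_betw d (dots F) (dots G)"
proof -
  from assms obtain b d b' d' where h: "diagram_hom S F G b d" "diagram_hom S G F b' d'"
    and inv: "\<forall>x\<in>boxes F. b' (b x) = x" "\<forall>x\<in>dots F. d' (d x) = x"
      "\<forall>x\<in>boxes G. b (b' x) = x" "\<forall>x\<in>dots G. d (d' x) = x"
    unfolding diagram_iso_def by blast
  interpret FG: diagram_hom S F G b d by fact
  interpret GF: diagram_hom S G F b' d' by fact
  have "bij_betw b (boxes F) (boxes G)" "bij_betw d (dots F) (dots G)"
    using inv FG.boxes GF.boxes FG.dots GF.dots
    by (auto intro!: bij_betw_byWitness[where f' = b'] bij_betw_byWitness[where f' = d'])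
  with h that show ?thesis by blast
qed

text \<open>The inverse of a bijective homomorphism is again a homomorphism: every port of
  \<open>G\<close> is the image of a port of \<open>F\<close>. Well-formedness of \<open>F\<close>
  puts the ends of its wires in \<open>dots F\<close>, where \<open>d'\<close> undoes
  \<open>d\<close>.\<close>

lemma diagram_isoI:
  assumes "dot_diagram S F" and hom: "diagram_hom S F G b d"
    and b: "bij_betw b (boxes F) (boxes G)" and d: "bij_betw d (dots F) (dots G)"
  shows "diagram_iso S F G"
proof -
  interpret F: dot_diagram S F by fact
  interpret FG: diagram_hom S F G b d by fact
  define b' d' where "b' = inv_into (boxes F) b" and "d' = inv_into (dots F) d"
  have b': "b' (b x) = x" if "x \<in> boxes F" for x
    using b that by (simp add: b'_def bij_betw_inv_into_left)
  have d': "d' (d x) = x" if "x \<in> dots F" for x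
    using d that by (simp add: d'_def bij_betw_inv_into_left)
  have eqs: "boxes G = b ` boxes F" "dots G = d ` dots F"
    using b d by (simp_all add: bij_betw_def)
  have "diagram_hom S G F b' d'"
    by standard
      (auto simp: eqs b' d' FG.n_in FG.n_out FG.blab FG.dlab FG.win_Box FG.wout_Box
        FG.win_Ext FG.wout_Ext F.win F.wout simp flip: FG.n_in FG.n_out)
  with hom show ?thesis
    unfolding diagram_iso_def eqs
    by (intro exI[of _ b] exI[of _ d] exI[of _ b'] exI[of _ d']) (auto simp: b' d')
qed

lemma diagram_iso_trans:
  assumes "dot_diagram S F" "diagram_iso S F G" "diagram_iso S G H"
  shows "diagram_iso S F H"
proof -
  obtain b d b' d' where "diagram_hom S F G b d" "bij_betw b (boxes F) (boxes G)"
    "bij_betw d (dots F) (dots G)" "diagram_hom S G H b' d'" "bij_betw b' (boxes G) (boxes H)"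
    "bij_betw d' (dots G) (dots H)"
    using assms by (metis diagram_iso_bijE)
  then show ?thesis
    using assms(1)
    by (intro diagram_isoI[where b = "b' \<circ> b" and d = "d' \<circ> d"])
      (auto intro: diagram_hom_comp bij_betw_trans)
qed

lemma diag_dom_hom:
  assumes "dot_diagram S F" "diagram_hom S F G b d"
  shows "diag_dom G = diag_dom F" and "diag_cod G = diag_cod F"
proof -
  interpret F: dot_diagram S F by fact
  interpret FG: diagram_hom S F G b d by fact
  show "diag_dom G = diag_dom F" "diag_cod G = diag_cod F"
    by (auto simp: diag_dom_def diag_cod_def FG.win_Ext FG.wout_Ext FG.dlab F.win F.wout
        simp flip: FG.n_in FG.n_out)
qed

lemma diag_dom_iso:
  assumes "dot_diagram S F" "diagram_iso S F G"
  shows "diag_dom G = diag_dom F" and "diag_cod G = diag_cod F"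
  using assms by (auto elim!: diagram_iso_bijE dest: diag_dom_hom)

lemma length_diag_dom [simp]: "length (diag_dom F) = n_in F"
  and length_diag_cod [simp]: "length (diag_cod F) = n_out F"
  by (simp_all add: diag_dom_def diag_cod_def)

section \<open>Relabelling of diagrams and isomorphism classes\<close>

lemma finite_inj_into_infinite:
  assumes "finite A" and "infinite (UNIV :: 'b set)"
  obtains f :: "'a \<Rightarrow> 'b" where "inj_on f A"
proof -
  obtain B :: "'b set" where "finite B" "card B = card A"
    using assms(2) infinite_arbitrarily_large by blast
  then show ?thesis
    using assms(1) that finite_same_card_bij[of A B] by (auto simp: bij_betw_def)
qed

text \<open>Transport along injections of boxes and dots. With natural numbers it shows that classes
  are nonempty; with dots in \<open>'i elt\<close> it lets the dots of a target diagram serve as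
  elements of the objects of \<open>Mat\<close>.\<close>

lemma diagram_relabel:
  fixes F :: "('o, 'm, 'b, 'd) diagram"
  assumes "dot_diagram S F" and "infinite (UNIV :: 'c set)" and "infinite (UNIV :: 'e set)"
  obtains G :: "('o, 'm, 'c, 'e) diagram" where "dot_diagram S G" "diagram_iso S F G"
proof -
  interpret F: dot_diagram S F by fact
  obtain f :: "'b \<Rightarrow> 'c" where f: "inj_on f (boxes F)"
    using finite_inj_into_infinite F.finite_boxes assms(2) by blast
  obtain g :: "'d \<Rightarrow> 'e" where g: "inj_on g (dots F)"
    using finite_inj_into_infinite F.finite_dots assms(3) by blast
  define f' g' where "f' = inv_into (boxes F) f" and "g' = inv_into (dots F) g"
  have f': "f' (f x) = x" if "x \<in> boxes F" for x using that f by (simp add: f'_def)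
  have g': "g' (g x) = x" if "x \<in> dots F" for x using that g by (simp add: g'_def)
  define G :: "('o, 'm, 'c, 'e) diagram" where
    "G = \<lparr>boxes = f ` boxes F, dots = g ` dots F, n_in = n_in F, n_out = n_out F,
      blab = blab F \<circ> f', dlab = dlab F \<circ> g',
      win = (\<lambda>x. g (win F (map_port f' x))), wout = (\<lambda>x. g (wout F (map_port f' x)))\<rparr>"
  have "diagram_hom S F G f g"
    by standard (auto simp: G_def f' g')
  then have "diagram_iso S F G"
    using f g by (intro diagram_isoI[OF assms(1)]) (auto simp: bij_betw_def G_def)
  moreover have "dot_diagram S G"
    by standard
      (auto simp: G_def f' g' F.finite_boxes F.finite_dots F.blab F.dlab F.win F.wout F.dlab_win
        F.dlab_wout inputs_def outputs_def)
  ultimately show ?thesis using that by blast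
qed

lemma dcls_nonempty:
  assumes "dot_diagram S F"
  shows "dcls S F \<noteq> {}"
proof -
  obtain G :: "('a, 'b, nat, nat) diagram" where "dot_diagram S G" "diagram_iso S F G"
    using diagram_relabel[OF assms infinite_UNIV_nat infinite_UNIV_nat] .
  then show ?thesis
    unfolding dcls_def by (blast intro: diagram_iso_sym)
qed

text \<open>The easy direction of the theorem: isomorphic diagrams are the same morphism, so every
  functor agrees on them.\<close>

lemma dcls_eq:
  assumes "diagram_iso S F G"
  shows "dcls S F = dcls S G"
  unfolding dcls_def using assms by (metis diagram_iso_sym diagram_iso_trans)

section \<open>Evaluation of dot-diagrams by state sums\<close>

text \<open>Extensional functions, so that each assignment of colours to the dots contributes one
  summand and finite colour sets give finitely many summands.\<close>

definition colourings :: "('o \<Rightarrow> 'x set) \<Rightarrow> ('o, 'm, 'b, 'd) diagram \<Rightarrow> ('d \<Rightarrow> 'x) set" where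
  "colourings X F = (\<Pi>\<^sub>E d\<in>dots F. X (dlab F d))"

definition ext_in :: "('o, 'm, 'b, 'd) diagram \<Rightarrow> ('d \<Rightarrow> 'x) \<Rightarrow> 'x list" where
  "ext_in F x = map (\<lambda>i. x (win F (Ext i))) [0..<n_in F]"

definition ext_out :: "('o, 'm, 'b, 'd) diagram \<Rightarrow> ('d \<Rightarrow> 'x) \<Rightarrow> 'x list" where
  "ext_out F x = map (\<lambda>j. x (wout F (Ext j))) [0..<n_out F]"

definition box_in ::
  "('o, 'm) signature \<Rightarrow> ('o, 'm, 'b, 'd) diagram \<Rightarrow> ('d \<Rightarrow> 'x) \<Rightarrow> 'b \<Rightarrow> 'x list" where
  "box_in S F x b = map (\<lambda>i. x (win F (Box b i))) [0..<length (sdom S (blab F b))]"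

definition box_out ::
  "('o, 'm) signature \<Rightarrow> ('o, 'm, 'b, 'd) diagram \<Rightarrow> ('d \<Rightarrow> 'x) \<Rightarrow> 'b \<Rightarrow> 'x list" where
  "box_out S F x b = map (\<lambda>j. x (wout F (Box b j))) [0..<length (scod S (blab F b))]"

definition weight ::
  "('o, 'm) signature \<Rightarrow> ('m \<Rightarrow> 'x list \<Rightarrow> 'x list \<Rightarrow> 'k::comm_semiring_1) \<Rightarrow>
    ('o, 'm, 'b, 'd) diagram \<Rightarrow> ('d \<Rightarrow> 'x) \<Rightarrow> 'k" where
  "weight S M F x = (\<Prod>b\<in>boxes F. M (blab F b) (box_in S F x b) (box_out S F x b))"

text \<open>The matrix entry at boundary words \<open>is\<close>, \<open>js\<close>. Coefficients in
  a commutative semiring allow the same definition over the field and over its polynomial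
  ring.\<close>

definition val ::
  "('o, 'm) signature \<Rightarrow> ('o \<Rightarrow> 'x set) \<Rightarrow> ('m \<Rightarrow> 'x list \<Rightarrow> 'x list \<Rightarrow> 'k::comm_semiring_1) \<Rightarrow>
    ('o, 'm, 'b, 'd) diagram \<Rightarrow> 'x list \<Rightarrow> 'x list \<Rightarrow> 'k" where
  "val S X M F is js =
    (\<Sum>x\<in>colourings X F. of_bool (ext_in F x = is \<and> ext_out F x = js) * weight S M F x)"

definition tups :: "('o \<Rightarrow> 'x set) \<Rightarrow> 'o list \<Rightarrow> 'x list set" where
  "tups X w = {xs. list_all2 (\<lambda>x a. x \<in> X a) xs w}"

lemma tups_Nil [simp]: "tups X [] = {[]}"
  by (auto simp: tups_def)

lemma tups_Cons: "tups X (a # w) = (\<lambda>(x, xs). x # xs) ` (X a \<times> tups X w)"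
  by (auto simp: tups_def list_all2_Cons2)

lemma Cons_in_tups [simp]: "x # xs \<in> tups X (a # w) \<longleftrightarrow> x \<in> X a \<and> xs \<in> tups X w"
  by (simp add: tups_def)

lemma finite_tups: "(\<And>a. a \<in> set w \<Longrightarrow> finite (X a)) \<Longrightarrow> finite (tups X w)"
  by (induction w) (auto simp: tups_Cons)

lemma length_tups: "xs \<in> tups X w \<Longrightarrow> length xs = length w"
  by (auto simp: tups_def list_all2_lengthD)

lemma append_in_tups:
  "length xs = length v \<Longrightarrow> xs @ ys \<in> tups X (v @ w) \<longleftrightarrow> xs \<in> tups X v \<and> ys \<in> tups X w"
  by (simp add: tups_def list_all2_append)

lemma take_drop_tups:
  "xs \<in> tups X (v @ w) \<Longrightarrow> take (length v) xs \<in> tups X v"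
  "xs \<in> tups X (v @ w) \<Longrightarrow> drop (length v) xs \<in> tups X w"
  by (auto simp: tups_def list_all2_append2)

lemma append_tupsE:
  assumes "xs \<in> tups X (v @ w)"
  obtains ys zs where "xs = ys @ zs" "ys \<in> tups X v" "zs \<in> tups X w" "length ys = length v"
  using assms by (auto simp: tups_def list_all2_append2)

section \<open>Colourings of quotients and of disjoint unions\<close>

text \<open>A function on a quotient is a function on \<open>A\<close> that is constant on the
  fibres of \<open>q\<close>; the inverse evaluates at a chosen representative. It serves both for
  renaming dots, where \<open>q\<close> is injective, and for the pushout in a composite.\<close>

lemma PiE_quotient:
  assumes "q ` A = Q"
  shows "bij_betw (\<lambda>z. restrict (z \<circ> q) A) (Pi\<^sub>E Q Y)
    {x \<in> \<Pi>\<^sub>E a\<in>A. Y (q a). \<forall>a\<in>A. \<forall>a'\<in>A. q a = q a' \<longrightarrow> x a = x a'}"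
    (is "bij_betw ?f _ ?R")
proof (rule bij_betw_byWitness[where f' = "\<lambda>x. \<lambda>c\<in>Q. x (inv_into A q c)"])
  have inv: "inv_into A q c \<in> A" "q (inv_into A q c) = c" if "c \<in> Q" for c
    using that assms by (auto intro: inv_into_into f_inv_into_f)
  show "\<forall>z\<in>Pi\<^sub>E Q Y. (\<lambda>c\<in>Q. ?f z (inv_into A q c)) = z"
  proof (intro ballI ext)
    fix z c assume "z \<in> Pi\<^sub>E Q Y"
    then show "(\<lambda>c\<in>Q. ?f z (inv_into A q c)) c = z c"
      by (cases "c \<in> Q") (simp_all add: inv PiE_arb[of z Q Y])
  qed
  show "\<forall>x\<in>?R. ?f (\<lambda>c\<in>Q. x (inv_into A q c)) = x"
  proof
    fix x assume "x \<in> ?R"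
    then have x: "x \<in> (\<Pi>\<^sub>E a\<in>A. Y (q a))"
      and eq: "\<And>a a'. a \<in> A \<Longrightarrow> a' \<in> A \<Longrightarrow> q a = q a' \<Longrightarrow> x a = x a'"
      unfolding mem_Collect_eq by (rule conjunct1, metis)
    have "?f (\<lambda>c\<in>Q. x (inv_into A q c)) a = x a" for a
    proof (cases "a \<in> A")
      case True
      then have "q a \<in> Q" using assms by blast
      moreover have "x (inv_into A q (q a)) = x a"
        using inv[OF \<open>q a \<in> Q\<close>] True by (intro eq)
      ultimately show ?thesis
        using True by simp
    next
      case False
      with PiE_arb[OF x] show ?thesis
        by simp
    qed
    then show "?f (\<lambda>c\<in>Q. x (inv_into A q c)) = x" by (rule ext)
  qed
  show "?f ` Pi\<^sub>E Q Y \<subseteq> ?R"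
  proof (rule image_subsetI)
    fix z assume z: "z \<in> Pi\<^sub>E Q Y"
    have "z (q a) \<in> Y (q a)" if "a \<in> A" for a
      using that assms PiE_mem[OF z, of "q a"] by auto
    then show "?f z \<in> ?R"
      by simp
  qed
  show "(\<lambda>x. \<lambda>c\<in>Q. x (inv_into A q c)) ` ?R \<subseteq> Pi\<^sub>E Q Y"
  proof (rule image_subsetI)
    fix x assume "x \<in> ?R"
    then have "x \<in> (\<Pi>\<^sub>E a\<in>A. Y (q a))"
      unfolding mem_Collect_eq by (rule conjunct1)
    then have "x (inv_into A q c) \<in> Y c" if "c \<in> Q" for c
      using inv[OF that] PiE_mem[of x A "\<lambda>a. Y (q a)" "inv_into A q c"] by simp
    then show "(\<lambda>c\<in>Q. x (inv_into A q c)) \<in> Pi\<^sub>E Q Y"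
      by simp
  qed
qed

text \<open>Splitting and \<open>case_sum\<close> are mutually inverse on all functions; what needs
  checking is that both preserve the default value outside the domains.\<close>

lemma PiE_Plus:
  "bij_betw (\<lambda>z. (z \<circ> Inl, z \<circ> Inr)) (Pi\<^sub>E (A <+> B) Y)
    ((\<Pi>\<^sub>E a\<in>A. Y (Inl a)) \<times> (\<Pi>\<^sub>E b\<in>B. Y (Inr b)))"
proof (rule bij_betw_byWitness[where f' = "\<lambda>(x, y). case_sum x y"])
  show "\<forall>z\<in>Pi\<^sub>E (A <+> B) Y. (case (z \<circ> Inl, z \<circ> Inr) of (x, y) \<Rightarrow> case_sum x y) = z"
    by (auto simp: fun_eq_iff split: sum.split)
  show "\<forall>p\<in>(\<Pi>\<^sub>E a\<in>A. Y (Inl a)) \<times> (\<Pi>\<^sub>E b\<in>B. Y (Inr b)).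
      ((case p of (x, y) \<Rightarrow> case_sum x y) \<circ> Inl, (case p of (x, y) \<Rightarrow> case_sum x y) \<circ> Inr) = p"
    by (auto simp: fun_eq_iff)
  show "(\<lambda>z. (z \<circ> Inl, z \<circ> Inr)) ` Pi\<^sub>E (A <+> B) Y
      \<subseteq> (\<Pi>\<^sub>E a\<in>A. Y (Inl a)) \<times> (\<Pi>\<^sub>E b\<in>B. Y (Inr b))"
  proof (rule image_subsetI)
    fix z assume z: "z \<in> Pi\<^sub>E (A <+> B) Y"
    show "(z \<circ> Inl, z \<circ> Inr) \<in> (\<Pi>\<^sub>E a\<in>A. Y (Inl a)) \<times> (\<Pi>\<^sub>E b\<in>B. Y (Inr b))"
      using PiE_mem[OF z] PiE_arb[OF z] by (intro SigmaI PiE_I) auto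
  qed
  show "(\<lambda>(x, y). case_sum x y) ` ((\<Pi>\<^sub>E a\<in>A. Y (Inl a)) \<times> (\<Pi>\<^sub>E b\<in>B. Y (Inr b)))
      \<subseteq> Pi\<^sub>E (A <+> B) Y"
  proof (rule image_subsetI)
    fix p assume "p \<in> (\<Pi>\<^sub>E a\<in>A. Y (Inl a)) \<times> (\<Pi>\<^sub>E b\<in>B. Y (Inr b))"
    then obtain x y where p: "p = (x, y)"
      and x: "x \<in> (\<Pi>\<^sub>E a\<in>A. Y (Inl a))" and y: "y \<in> (\<Pi>\<^sub>E b\<in>B. Y (Inr b))"
      by (rule mem_Times_iff[THEN iffD1, THEN conjE]) (metis prod.collapse)
    have "case_sum x y c = undefined" if "c \<notin> A <+> B" for c
      using that PiE_arb[OF x] PiE_arb[OF y] by (cases c) auto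
    then show "(case p of (x, y) \<Rightarrow> case_sum x y) \<in> Pi\<^sub>E (A <+> B) Y"
      using PiE_mem[OF x] PiE_mem[OF y] unfolding p by (intro PiE_I) auto
  qed
qed

context dot_diagram
begin

lemma box_in_cong:
  "b \<in> boxes F \<Longrightarrow> (\<And>d. d \<in> dots F \<Longrightarrow> x d = y d) \<Longrightarrow> box_in S F x b = box_in S F y b"
  and box_out_cong:
  "b \<in> boxes F \<Longrightarrow> (\<And>d. d \<in> dots F \<Longrightarrow> x d = y d) \<Longrightarrow> box_out S F x b = box_out S F y b"
  by (auto simp: box_in_def box_out_def win wout)

lemma weight_cong: "(\<And>d. d \<in> dots F \<Longrightarrow> x d = y d) \<Longrightarrow> weight S M F x = weight S M F y"
  unfolding weight_def using box_in_cong[of _ x y] box_out_cong[of _ x y] by simp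

lemma ext_in_tups: "x \<in> colourings X F \<Longrightarrow> ext_in F x \<in> tups X (diag_dom F)"
  and ext_out_tups: "x \<in> colourings X F \<Longrightarrow> ext_out F x \<in> tups X (diag_cod F)"
  by (auto simp: ext_in_def ext_out_def diag_dom_def diag_cod_def tups_def colourings_def
      list_all2_conv_all_nth win wout)

lemma diag_dom_lists: "diag_dom F \<in> lists (Obj S)"
  and diag_cod_lists: "diag_cod F \<in> lists (Obj S)"
  by (auto simp: diag_dom_def diag_cod_def dlab win wout)

lemma val_outside:
  assumes "is \<notin> tups X (diag_dom F) \<or> js \<notin> tups X (diag_cod F)"
  shows "val S X M F is js = 0"
  unfolding val_def using assms ext_in_tups ext_out_tups by (intro sum.neutral) auto

lemma finite_colourings: "(\<And>a. a \<in> Obj S \<Longrightarrow> finite (X a)) \<Longrightarrow> finite (colourings X F)"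
  by (auto simp: colourings_def finite_dots dlab intro!: finite_PiE)

end

text \<open>Pulling a colouring back along \<open>d\<close> is a bijection that preserves boundary
  words, and reindexing the product along \<open>b\<close> shows that it preserves weights.\<close>

lemma val_hom:
  fixes X :: "'o \<Rightarrow> 'x set"
  assumes F: "dot_diagram S F" and hom: "diagram_hom S F G b d"
    and b: "bij_betw b (boxes F) (boxes G)" and d: "bij_betw d (dots F) (dots G)"
  shows "val S X M G is js = val S X M F is js"
proof -
  interpret F: dot_diagram S F by fact
  interpret FG: diagram_hom S F G b d by fact
  let ?r = "\<lambda>x. restrict (x \<circ> d) (dots F)"
  have "inj_on d (dots F)" "d ` dots F = dots G" using d by (auto simp: bij_betw_def)
  \<comment> \<open>Injectivity of \<open>d\<close> makes the fibre condition of
    \<open>PiE_quotient\<close> vacuous, so its range is the whole set of colourings of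
    \<open>F\<close>.\<close>
  have eq: "colourings X F =
    {x \<in> \<Pi>\<^sub>E a\<in>dots F. X (dlab G (d a)). \<forall>a\<in>dots F. \<forall>a'\<in>dots F. d a = d a' \<longrightarrow> x a = x a'}"
  proof -
    have "colourings X F = (\<Pi>\<^sub>E a\<in>dots F. X (dlab G (d a)))"
      unfolding colourings_def by (rule PiE_cong) (simp add: FG.dlab)
    then show ?thesis
      using \<open>inj_on d (dots F)\<close> by (auto dest: inj_onD)
  qed
  have bij: "bij_betw ?r (colourings X G) (colourings X F)"
    unfolding eq using \<open>d ` dots F = dots G\<close> unfolding colourings_def by (rule PiE_quotient)
  have "weight S M G x = weight S M F (?r x)" for x
  proof -
    have "weight S M G x = (\<Prod>c\<in>boxes F. M (blab F c) (box_in S F (x \<circ> d) c) (box_out S F (x \<circ> d) c))"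
      unfolding weight_def using b
      by (subst prod.reindex_bij_betw[symmetric, OF b])
        (auto intro!: prod.cong arg_cong2[where f = "M _"]
          simp: FG.blab box_in_def box_out_def FG.win_Box FG.wout_Box)
    also have "\<dots> = weight S M F (x \<circ> d)"
      by (simp add: weight_def)
    also have "\<dots> = weight S M F (?r x)"
      by (rule F.weight_cong) simp
    finally show ?thesis .
  qed
  moreover have "ext_in G x = ext_in F (?r x)" "ext_out G x = ext_out F (?r x)" for x :: "_ \<Rightarrow> 'x"
    by (auto simp: ext_in_def ext_out_def FG.win_Ext FG.wout_Ext F.win F.wout
        simp flip: FG.n_in FG.n_out)
  ultimately show ?thesis
    unfolding val_def by (subst sum.reindex_bij_betw[OF bij, symmetric]) simp
qed

lemma val_iso:
  assumes "dot_diagram S F" "diagram_iso S F G"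
  shows "val S X M G = val S X M F"
proof -
  obtain b d where "diagram_hom S F G b d" "bij_betw b (boxes F) (boxes G)"
    "bij_betw d (dots F) (dots G)"
    using assms(2) by (rule diagram_iso_bijE)
  then show ?thesis
    using val_hom[OF assms(1)] by blast
qed

section \<open>State sums of composite diagrams\<close>

lemma diag_tensor_simps [simp]:
  "boxes (diag_tensor F G) = boxes F <+> boxes G"
  "dots (diag_tensor F G) = dots F <+> dots G"
  "n_in (diag_tensor F G) = n_in F + n_in G"
  "n_out (diag_tensor F G) = n_out F + n_out G"
  "blab (diag_tensor F G) = case_sum (blab F) (blab G)"
  "dlab (diag_tensor F G) = case_sum (dlab F) (dlab G)"
  "win (diag_tensor F G) (Box (Inl b) i) = Inl (win F (Box b i))"
  "win (diag_tensor F G) (Box (Inr c) i) = Inr (win G (Box c i))"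
  "wout (diag_tensor F G) (Box (Inl b) i) = Inl (wout F (Box b i))"
  "wout (diag_tensor F G) (Box (Inr c) i) = Inr (wout G (Box c i))"
  "win (diag_tensor F G) (Ext k) =
    (if k < n_in F then Inl (win F (Ext k)) else Inr (win G (Ext (k - n_in F))))"
  "wout (diag_tensor F G) (Ext k) =
    (if k < n_out F then Inl (wout F (Ext k)) else Inr (wout G (Ext (k - n_out F))))"
  by (simp_all add: diag_tensor_def)

lemma diag_comp_simps [simp]:
  "boxes (diag_comp G F) = boxes F <+> boxes G"
  "dots (diag_comp G F) = glue_class G F ` (dots F <+> dots G)"
  "n_in (diag_comp G F) = n_in F"
  "n_out (diag_comp G F) = n_out G"
  "blab (diag_comp G F) = case_sum (blab F) (blab G)"
  "win (diag_comp G F) (Box (Inl b) i) = glue_class G F (Inl (win F (Box b i)))"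
  "win (diag_comp G F) (Box (Inr c) i) = glue_class G F (Inr (win G (Box c i)))"
  "wout (diag_comp G F) (Box (Inl b) i) = glue_class G F (Inl (wout F (Box b i)))"
  "wout (diag_comp G F) (Box (Inr c) i) = glue_class G F (Inr (wout G (Box c i)))"
  "win (diag_comp G F) (Ext k) = glue_class G F (Inl (win F (Ext k)))"
  "wout (diag_comp G F) (Ext k) = glue_class G F (Inr (wout G (Ext k)))"
  by (simp_all add: diag_comp_def)

lemma diag_dag_simps [simp]:
  "boxes (diag_dag S F) = boxes F" "dots (diag_dag S F) = dots F"
  "n_in (diag_dag S F) = n_out F" "n_out (diag_dag S F) = n_in F"
  "blab (diag_dag S F) b = sdag S (blab F b)" "dlab (diag_dag S F) = dlab F"
  "win (diag_dag S F) = wout F" "wout (diag_dag S F) = win F"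
  by (simp_all add: diag_dag_def)

lemma box_free_simps [simp]:
  "boxes (box_free w m n f g) = {}" "dots (box_free w m n f g) = {..<length w}"
  "n_in (box_free w m n f g) = m" "n_out (box_free w m n f g) = n"
  "dlab (box_free w m n f g) i = w ! i"
  "win (box_free w m n f g) (Ext i) = f i" "wout (box_free w m n f g) (Ext i) = g i"
  by (simp_all add: box_free_def)

lemma upt_add_map: "[0..<m + n] = [0..<m] @ map (\<lambda>i. m + i) [0..<n]"
  by (rule nth_equalityI) (auto simp: nth_append)

lemma dot_diagramI:
  assumes "finite (boxes F)" "finite (dots F)"
    and "\<And>b. b \<in> boxes F \<Longrightarrow> blab F b \<in> Mor S"
    and "\<And>d. d \<in> dots F \<Longrightarrow> dlab F d \<in> Obj S"
    and "\<And>i. i < n_in F \<Longrightarrow> win F (Ext i) \<in> dots F"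
    and "\<And>j. j < n_out F \<Longrightarrow> wout F (Ext j) \<in> dots F"
    and "\<And>b i. b \<in> boxes F \<Longrightarrow> i < length (sdom S (blab F b)) \<Longrightarrow>
      win F (Box b i) \<in> dots F \<and> dlab F (win F (Box b i)) = sdom S (blab F b) ! i"
    and "\<And>b j. b \<in> boxes F \<Longrightarrow> j < length (scod S (blab F b)) \<Longrightarrow>
      wout F (Box b j) \<in> dots F \<and> dlab F (wout F (Box b j)) = scod S (blab F b) ! j"
  shows "dot_diagram S F"
  by standard (use assms in \<open>auto simp: inputs_def outputs_def\<close>)

section \<open>Disjoint unions\<close>

lemma dot_diagram_tensor:
  assumes "dot_diagram S F" "dot_diagram S G"
  shows "dot_diagram S (diag_tensor F G)"
proof -
  interpret F: dot_diagram S F by fact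
  interpret G: dot_diagram S G by fact
  show ?thesis
    by (rule dot_diagramI)
      (auto simp: F.finite_boxes F.finite_dots G.finite_boxes G.finite_dots F.blab G.blab F.dlab
        G.dlab F.win G.win F.wout G.wout F.dlab_win G.dlab_win F.dlab_wout G.dlab_wout)
qed

lemma diag_dom_tensor [simp]: "diag_dom (diag_tensor F G) = diag_dom F @ diag_dom G"
  and diag_cod_tensor [simp]: "diag_cod (diag_tensor F G) = diag_cod F @ diag_cod G"
  by (auto simp: diag_dom_def diag_cod_def upt_add_map)

lemma ext_in_tensor: "ext_in (diag_tensor F G) z = ext_in F (z \<circ> Inl) @ ext_in G (z \<circ> Inr)"
  and ext_out_tensor: "ext_out (diag_tensor F G) z = ext_out F (z \<circ> Inl) @ ext_out G (z \<circ> Inr)"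
  by (auto simp: ext_in_def ext_out_def upt_add_map)

lemma weight_tensor:
  assumes "dot_diagram S F" "dot_diagram S G"
  shows "weight S M (diag_tensor F G) z = weight S M F (z \<circ> Inl) * weight S M G (z \<circ> Inr)"
  using dot_diagram.finite_boxes[OF assms(1)] dot_diagram.finite_boxes[OF assms(2)]
  by (simp add: weight_def prod.Plus box_in_def box_out_def)

lemma length_ext [simp]: "length (ext_in F x) = n_in F" "length (ext_out F x) = n_out F"
  by (simp_all add: ext_in_def ext_out_def)

text \<open>A colouring of the disjoint union is a pair of colourings, and both its weight and its
  boundary condition factor; a sum over pairs of products is then a product of sums.\<close>

lemma val_tensor:
  assumes "dot_diagram S F" "dot_diagram S G"
  shows "val S X M (diag_tensor F G) is js =
    val S X M F (take (n_in F) is) (take (n_out F) js) *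
    val S X M G (drop (n_in F) is) (drop (n_out F) js)"
proof -
  let ?T = "diag_tensor F G"
  have bij: "bij_betw (\<lambda>z. (z \<circ> Inl, z \<circ> Inr)) (colourings X ?T)
      (colourings X F \<times> colourings X G)"
    using PiE_Plus[of "dots F" "dots G" "\<lambda>d. X (dlab ?T d)"] by (simp add: colourings_def)
  have "val S X M ?T is js = (\<Sum>z\<in>colourings X ?T.
      (\<lambda>(x, y). (of_bool (ext_in F x = take (n_in F) is \<and> ext_out F x = take (n_out F) js)
          * weight S M F x)
        * (of_bool (ext_in G y = drop (n_in F) is \<and> ext_out G y = drop (n_out F) js)
          * weight S M G y)) (z \<circ> Inl, z \<circ> Inr))"
    unfolding val_def
    by (rule sum.cong)
      (auto simp: ext_in_tensor ext_out_tensor append_eq_conv_conj weight_tensor[OF assms])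
  also have "\<dots> = val S X M F (take (n_in F) is) (take (n_out F) js) *
    val S X M G (drop (n_in F) is) (drop (n_out F) js)"
    by (subst sum.reindex_bij_betw[OF bij])
      (simp add: val_def sum_product sum.cartesian_product)
  finally show ?thesis .
qed

section \<open>Daggers\<close>

lemma dot_diagram_dag:
  assumes "dagger_signature S" "dot_diagram S F"
  shows "dot_diagram S (diag_dag S F)"
proof -
  interpret S: dagger_signature S by fact
  interpret F: dot_diagram S F by fact
  show ?thesis
    by (rule dot_diagramI)
      (auto simp: F.finite_boxes F.finite_dots F.blab F.dlab F.win F.wout F.dlab_win F.dlab_wout
        S.sdom_sdag S.scod_sdag S.sdag)
qed

lemma diag_dom_dag [simp]: "diag_dom (diag_dag S F) = diag_cod F"
  and diag_cod_dag [simp]: "diag_cod (diag_dag S F) = diag_dom F"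
  by (simp_all add: diag_dom_def diag_cod_def)

text \<open>A diagram and its dagger have the same colourings. As a ring homomorphism,
  \<open>bar\<close> passes through the sum and the product, and the assumption on \<open>M\<close>
  treats each box.\<close>

lemma val_dag:
  fixes F :: "('o, 'm, 'b, 'd) diagram" and X :: "'o \<Rightarrow> 'x set"
  assumes S: "dagger_signature S" and F: "dot_diagram S F"
    and bar: "bar 0 = 0" "bar 1 = 1" "\<And>x y. bar (x + y) = bar x + bar y"
      "\<And>x y. bar (x * y) = bar x * bar y"
    and M: "\<And>f is js. f \<in> Mor S \<Longrightarrow> M (sdag S f) js is = bar (M f is js)"
  shows "val S X M (diag_dag S F) js is = bar (val S X M F is js)"
proof -
  interpret S: dagger_signature S by fact
  interpret F: dot_diagram S F by fact
  have bar_sum: "bar (sum h A) = (\<Sum>a\<in>A. bar (h a))" for h :: "('d \<Rightarrow> 'x) \<Rightarrow> _" and A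
    by (induction A rule: infinite_finite_induct) (simp_all add: bar)
  have bar_prod: "bar (prod h A) = (\<Prod>a\<in>A. bar (h a))" for h :: "'b \<Rightarrow> _" and A
    by (induction A rule: infinite_finite_induct) (simp_all add: bar)
  have "weight S M (diag_dag S F) x = bar (weight S M F x)" for x
    unfolding weight_def bar_prod
    by (intro prod.cong)
      (simp_all add: box_in_def box_out_def S.sdom_sdag S.scod_sdag F.blab M)
  then show ?thesis
    unfolding val_def bar_sum
    by (intro sum.cong) (auto simp: colourings_def ext_in_def ext_out_def bar)
qed

section \<open>Composition by pushout of dots\<close>

definition glue_rel ::
  "('o, 'm, 'c, 'e) diagram \<Rightarrow> ('o, 'm, 'b, 'd) diagram \<Rightarrow> (('d + 'e) \<times> ('d + 'e)) set" where
  "glue_rel G F = (glue G F \<union> (glue G F)\<inverse>)\<^sup>*"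

lemma glue_class_eq_iff: "glue_class G F x = glue_class G F y \<longleftrightarrow> (x, y) \<in> glue_rel G F"
proof -
  have "sym (glue_rel G F)"
    unfolding glue_rel_def by (intro sym_rtrancl sym_Un_converse)
  moreover have "trans (glue_rel G F)" "refl (glue_rel G F)"
    by (simp_all add: glue_rel_def trans_rtrancl refl_rtrancl)
  ultimately have "equiv UNIV (glue_rel G F)"
    by (simp add: equiv_def)
  then show ?thesis
    unfolding glue_class_def glue_rel_def[symmetric] by (simp add: equiv_class_eq_iff)
qed

text \<open>The universal property of the pushout: a function compatible with the generating pairs
  is constant on classes. It is applied to labels and to colourings.\<close>

lemma glue_rel_invariant:
  assumes "(x, y) \<in> glue_rel G F"
    and "\<And>j. j < n_out F \<Longrightarrow> h (Inl (wout F (Ext j))) = h (Inr (win G (Ext j)))"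
  shows "h x = h y"
  using assms(1) unfolding glue_rel_def
  by (induction rule: rtrancl_induct) (auto simp: glue_def assms(2))

lemma glue_class_glue:
  "j < n_out F \<Longrightarrow> glue_class G F (Inl (wout F (Ext j))) = glue_class G F (Inr (win G (Ext j)))"
  unfolding glue_class_eq_iff glue_rel_def by (auto simp: glue_def)

lemma sum_of_bool_eq:
  fixes g :: "'a \<Rightarrow> 'k::comm_semiring_1"
  assumes "finite A" "a \<in> A"
  shows "(\<Sum>b\<in>A. of_bool (a = b) * g b) = g a" and "(\<Sum>b\<in>A. of_bool (b = a) * g b) = g a"
    and "(\<Sum>b\<in>A. g b * of_bool (a = b)) = g a" and "(\<Sum>b\<in>A. g b * of_bool (b = a)) = g a"
proof -
  have "(\<Sum>b\<in>A. of_bool (a = b) * g b) = (\<Sum>b\<in>{a}. of_bool (a = b) * g b)"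
    using assms by (intro sum.mono_neutral_right) auto
  then show "(\<Sum>b\<in>A. of_bool (a = b) * g b) = g a" by simp
  then show "(\<Sum>b\<in>A. of_bool (b = a) * g b) = g a" "(\<Sum>b\<in>A. g b * of_bool (a = b)) = g a"
    "(\<Sum>b\<in>A. g b * of_bool (b = a)) = g a"
    by (simp_all add: eq_commute[of _ a] mult.commute[of "g _"])
qed

locale composable = F: dot_diagram S F + G: dot_diagram S G
  for S :: "('o, 'm) signature" and F :: "('o, 'm, 'b, 'd) diagram"
    and G :: "('o, 'm, 'c, 'e) diagram" +
  assumes cod_dom: "diag_cod F = diag_dom G"
begin

lemma n_out_n_in: "n_out F = n_in G"
  using cod_dom by (metis length_diag_dom length_diag_cod)

lemma dlab_glue: "j < n_out F \<Longrightarrow> dlab F (wout F (Ext j)) = dlab G (win G (Ext j))"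
  using arg_cong[OF cod_dom, of "\<lambda>w. w ! j"] n_out_n_in by (simp add: diag_cod_def diag_dom_def)

text \<open>Labels are well defined on the pushout: matching boundary words make glued dots equally
  labelled, so \<open>the_elem\<close> is taken of a singleton.\<close>

lemma dlab_comp: "dlab (diag_comp G F) (glue_class G F x) = case_sum (dlab F) (dlab G) x"
proof -
  have "case_sum (dlab F) (dlab G) y = case_sum (dlab F) (dlab G) x"
    if "(x, y) \<in> glue_rel G F" for y
    using glue_rel_invariant[OF that, of "case_sum (dlab F) (dlab G)"] dlab_glue by simp
  moreover have "(x, x) \<in> glue_rel G F"
    by (simp add: glue_rel_def)
  ultimately have "case_sum (dlab F) (dlab G) ` glue_class G F x = {case_sum (dlab F) (dlab G) x}"
    unfolding glue_class_def glue_rel_def[symmetric] by blast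
  then show ?thesis
    by (simp add: diag_comp_def)
qed

lemma dot_diagram_comp: "dot_diagram S (diag_comp G F)"
  by (rule dot_diagramI)
    (auto simp: dlab_comp F.finite_boxes F.finite_dots G.finite_boxes G.finite_dots F.blab G.blab
      F.dlab G.dlab F.win G.win F.wout G.wout F.dlab_win G.dlab_win F.dlab_wout G.dlab_wout)

lemma diag_dom_comp: "diag_dom (diag_comp G F) = diag_dom F"
  and diag_cod_comp: "diag_cod (diag_comp G F) = diag_cod G"
  by (simp_all add: diag_dom_def diag_cod_def dlab_comp)

definition split_colouring :: "(('d + 'e) set \<Rightarrow> 'x) \<Rightarrow> ('d \<Rightarrow> 'x) \<times> ('e \<Rightarrow> 'x)" where
  "split_colouring z = (let r = restrict (z \<circ> glue_class G F) (dots F <+> dots G)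
     in (r \<circ> Inl, r \<circ> Inr))"

text \<open>Colourings turn the pushout of dots into a pullback: a colouring of the composite is a
  pair of colourings that agree along the shared boundary.\<close>

lemma bij_split_colouring:
  fixes X :: "'o \<Rightarrow> 'x set"
  shows "bij_betw split_colouring (colourings X (diag_comp G F))
    {p \<in> colourings X F \<times> colourings X G. ext_out F (fst p) = ext_in G (snd p)}"
proof -
  let ?A = "dots F <+> dots G" and ?q = "glue_class G F"
  let ?l = "case_sum (dlab F) (dlab G)"
  let ?P = "\<lambda>x. \<forall>j<n_out F. x (Inl (wout F (Ext j))) = x (Inr (win G (Ext j)))"
  have "(\<forall>a\<in>?A. \<forall>a'\<in>?A. ?q a = ?q a' \<longrightarrow> x a = x a') \<longleftrightarrow> ?P x" for x :: "_ \<Rightarrow> 'x"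
  proof
    assume *: "\<forall>a\<in>?A. \<forall>a'\<in>?A. ?q a = ?q a' \<longrightarrow> x a = x a'"
    show "?P x"
    proof (intro allI impI)
      fix j assume "j < n_out F"
      then have "Inl (wout F (Ext j)) \<in> ?A" "Inr (win G (Ext j)) \<in> ?A"
        using F.wout[of "Ext j"] G.win[of "Ext j"] n_out_n_in by auto
      with * show "x (Inl (wout F (Ext j))) = x (Inr (win G (Ext j)))"
        using glue_class_glue[OF \<open>j < n_out F\<close>] by metis
    qed
  next
    assume "?P x"
    then show "\<forall>a\<in>?A. \<forall>a'\<in>?A. ?q a = ?q a' \<longrightarrow> x a = x a'"
      unfolding glue_class_eq_iff using glue_rel_invariant[of _ _ G F x] by blast
  qed
  then have "bij_betw (\<lambda>z. restrict (z \<circ> ?q) ?A) (colourings X (diag_comp G F))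
      {x \<in> \<Pi>\<^sub>E a\<in>?A. X (?l a). ?P x}"
    using PiE_quotient[of ?q ?A "dots (diag_comp G F)" "\<lambda>c. X (dlab (diag_comp G F) c)"]
    by (simp add: colourings_def dlab_comp)
  moreover have "bij_betw (\<lambda>z. (z \<circ> Inl, z \<circ> Inr)) {x \<in> \<Pi>\<^sub>E a\<in>?A. X (?l a). ?P x}
      {p \<in> colourings X F \<times> colourings X G. ext_out F (fst p) = ext_in G (snd p)}"
  proof -
    have eq: "?P z \<longleftrightarrow> ext_out F (z \<circ> Inl) = ext_in G (z \<circ> Inr)" for z :: "_ \<Rightarrow> 'x"
      using n_out_n_in by (auto simp: ext_out_def ext_in_def list_eq_iff_nth_eq)
    show ?thesis
      unfolding eq colourings_def
      using PiE_Plus[of "dots F" "dots G" "\<lambda>d. X (?l d)"] by (intro bij_betw_Collect) simp_all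
  qed
  ultimately show ?thesis
    unfolding split_colouring_def[abs_def] Let_def by (auto dest: bij_betw_trans simp: comp_def)
qed

text \<open>Composition becomes matrix multiplication. After splitting colourings, the pairs are
  grouped by the word \<open>js\<close> of colours that they share on the boundary.\<close>

lemma val_comp:
  assumes X: "\<And>a. a \<in> Obj S \<Longrightarrow> finite (X a)"
  shows "val S X M (diag_comp G F) is ks =
    (\<Sum>js\<in>tups X (diag_cod F). val S X M F is js * val S X M G js ks)"
proof -
  let ?C = "diag_comp G F"
  have fin: "finite (colourings X F)" "finite (colourings X G)" "finite (tups X (diag_cod F))"
    using X F.finite_colourings G.finite_colourings F.diag_cod_lists by (auto intro!: finite_tups)
  define h where "h = (\<lambda>(x, y). of_bool (ext_in F x = is \<and> ext_out G y = ks)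
    * (weight S M F x * weight S M G y))"
  have "of_bool (ext_in ?C z = is \<and> ext_out ?C z = ks) * weight S M ?C z = h (split_colouring z)"
    for z
  proof -
    obtain x y where z: "split_colouring z = (x, y)" by fastforce
    then have x: "x d = z (glue_class G F (Inl d))" if "d \<in> dots F" for d
      using that by (auto simp: split_colouring_def Let_def)
    from z have y: "y d = z (glue_class G F (Inr d))" if "d \<in> dots G" for d
      using that by (auto simp: split_colouring_def Let_def)
    have "ext_in ?C z = ext_in F x" "ext_out ?C z = ext_out G y"
      by (auto simp: ext_in_def ext_out_def x y F.win G.wout)
    moreover have "weight S M ?C z = weight S M F x * weight S M G y"
      unfolding weight_def
      by (simp add: prod.Plus F.finite_boxes G.finite_boxes)
        (intro arg_cong2[where f = "(*)"] prod.cong arg_cong2[where f = "M _"];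
          simp add: box_in_def box_out_def x y F.win F.wout G.win G.wout)
    ultimately show ?thesis
      by (simp add: z h_def)
  qed
  then have "val S X M ?C is ks = (\<Sum>z\<in>colourings X ?C. h (split_colouring z))"
    by (simp add: val_def)
  also have "\<dots> = sum h {p \<in> colourings X F \<times> colourings X G. ext_out F (fst p) = ext_in G (snd p)}"
    by (rule sum.reindex_bij_betw) (rule bij_split_colouring)
  \<comment> \<open>The compatibility condition moves from the index set into the summand, which
    leaves a full product of index sets.\<close>
  also have "\<dots> = (\<Sum>(x, y)\<in>colourings X F \<times> colourings X G.
      of_bool (ext_out F x = ext_in G y) * h (x, y))"
    using fin by (intro sum.mono_neutral_cong_left) (auto simp: of_bool_def split: if_splits)
  \<comment> \<open>Equality of the two boundary words is resolved into a sum over a common value;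
    exactly one \<open>js\<close> contributes because \<open>ext_out F x\<close> lies in
    \<open>tups X (diag_cod F)\<close>.\<close>
  also have "\<dots> = (\<Sum>(x, y)\<in>colourings X F \<times> colourings X G. \<Sum>js\<in>tups X (diag_cod F).
      of_bool (ext_out F x = js) * (of_bool (js = ext_in G y) * h (x, y)))"
    using fin F.ext_out_tups
    by (intro sum.cong refl, clarify) (rule sum_of_bool_eq(1)[symmetric]; blast)
  also have "\<dots> = (\<Sum>js\<in>tups X (diag_cod F). \<Sum>(x, y)\<in>colourings X F \<times> colourings X G.
      of_bool (ext_out F x = js) * (of_bool (js = ext_in G y) * h (x, y)))"
    unfolding case_prod_unfold by (rule sum.swap)
  also have "\<dots> = (\<Sum>js\<in>tups X (diag_cod F). val S X M F is js * val S X M G js ks)"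
    unfolding val_def sum_product sum.cartesian_product h_def
    by (intro sum.cong refl) (clarsimp simp: of_bool_def)
  finally show ?thesis .
qed

end

section \<open>Box-free diagrams\<close>

lemma diag_dom_box_free: "diag_dom (box_free w m n f g) = map (\<lambda>i. w ! f i) [0..<m]"
  and diag_cod_box_free: "diag_cod (box_free w m n f g) = map (\<lambda>j. w ! g j) [0..<n]"
  by (simp_all add: diag_dom_def diag_cod_def)

lemma dot_diagram_box_free:
  assumes "w \<in> lists (Obj S)" "\<And>i. i < m \<Longrightarrow> f i < length w" "\<And>j. j < n \<Longrightarrow> g j < length w"
  shows "dot_diagram S (box_free w m n f g)"
  by (rule dot_diagramI) (use assms in auto)

lemma val_box_free:
  "val S X M (box_free w m n f g) is js = (\<Sum>x\<in>(\<Pi>\<^sub>E i\<in>{..<length w}. X (w ! i)).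
    of_bool (map (\<lambda>i. x (f i)) [0..<m] = is \<and> map (\<lambda>j. x (g j)) [0..<n] = js))"
  by (simp add: val_def colourings_def ext_in_def ext_out_def weight_def)

text \<open>Every dot carries exactly one input, so the input word determines the colouring and a
  single summand survives. Identities and swaps have this shape.\<close>

lemma val_box_free_perm:
  assumes X: "\<And>a. a \<in> set w \<Longrightarrow> finite (X a)" and xs: "is \<in> tups X w"
    and g: "\<And>j. j < n \<Longrightarrow> g j < length w"
  shows "val S X M (box_free w (length w) n (\<lambda>i. i) g) is js =
    of_bool (js = map (\<lambda>j. is ! g j) [0..<n])"
proof -
  let ?C = "\<Pi>\<^sub>E i\<in>{..<length w}. X (w ! i)" and ?x = "\<lambda>i\<in>{..<length w}. is ! i"
  have len: "length is = length w"
    using xs by (rule length_tups)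
  have x: "?x \<in> ?C"
    using xs by (auto simp: tups_def list_all2_conv_all_nth)
  have *: "map x [0..<length w] = is \<longleftrightarrow> ?x = x" if "x \<in> ?C" for x
  proof
    assume "map x [0..<length w] = is"
    then show "?x = x"
      using PiE_arb[OF that] by (auto simp: fun_eq_iff)
  next
    assume "?x = x"
    then have "x i = is ! i" if "i < length w" for i
      using that by (metis lessThan_iff restrict_apply')
    then show "map x [0..<length w] = is"
      using len by (auto intro: nth_equalityI)
  qed
  have "val S X M (box_free w (length w) n (\<lambda>i. i) g) is js =
    (\<Sum>x\<in>?C. of_bool (?x = x) * of_bool (map (\<lambda>j. x (g j)) [0..<n] = js))"
    unfolding val_box_free of_bool_conj using * by (intro sum.cong) simp_all
  also have "\<dots> = of_bool (map (\<lambda>j. ?x (g j)) [0..<n] = js)"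
    using X x by (intro sum_of_bool_eq) (auto intro!: finite_PiE)
  also have "map (\<lambda>j. ?x (g j)) [0..<n] = map (\<lambda>j. is ! g j) [0..<n]"
    using g by auto
  finally show ?thesis
    by (auto simp: of_bool_def)
qed

text \<open>A colouring of a single dot is the choice of one colour, which then appears at every
  port.\<close>

lemma val_spider:
  "val S X M (diag_spider a m n) is js =
    (\<Sum>c\<in>X a. of_bool (is = replicate m c \<and> js = replicate n c))"
proof -
  have eq: "{..<length [a]} = {0}"
    by auto
  have "bij_betw (\<lambda>x. x 0) (\<Pi>\<^sub>E i\<in>{0::nat}. X ([a] ! i)) (X a)"
  proof (rule bij_betw_byWitness[where f' = "\<lambda>c. \<lambda>i\<in>{0}. c"])
    show "\<forall>x\<in>\<Pi>\<^sub>E i\<in>{0::nat}. X ([a] ! i). (\<lambda>i\<in>{0}. x 0) = x"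
    proof (intro ballI ext)
      fix x i assume "x \<in> (\<Pi>\<^sub>E i\<in>{0::nat}. X ([a] ! i))"
      from PiE_arb[OF this, of i] show "(\<lambda>i\<in>{0}. x 0) i = x i"
        by (cases i) auto
    qed
    show "(\<lambda>x. x 0) ` (\<Pi>\<^sub>E i\<in>{0::nat}. X ([a] ! i)) \<subseteq> X a"
      using PiE_mem[of _ "{0::nat}" "\<lambda>i. X ([a] ! i)" 0] by auto
    show "(\<lambda>c. \<lambda>i\<in>{0}. c) ` X a \<subseteq> (\<Pi>\<^sub>E i\<in>{0::nat}. X ([a] ! i))"
      by (intro image_subsetI PiE_I) auto
  qed simp
  then show ?thesis
    unfolding diag_spider_def val_box_free eq
    by (subst sum.reindex_bij_betw[symmetric, where h = "\<lambda>x. x 0"])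
      (auto simp: map_replicate_const eq_commute[of "is"] eq_commute[of js])
qed

section \<open>Matrices\<close>

lemma mat_sel [simp]: "src (mat I J f) = I" "tgt (mat I J f) = J"
  "entry (mat I J f) i j = (if i \<in> I \<and> j \<in> J then f i j else 0)"
  by (simp_all add: mat_def)

lemma mat_cong: "(\<And>i j. i \<in> I \<Longrightarrow> j \<in> J \<Longrightarrow> f i j = g i j) \<Longrightarrow> mat I J f = mat I J g"
  by (auto simp: mat_def fun_eq_iff)

lemma fun_mat_cong: "(\<And>i. i \<in> I \<Longrightarrow> g i = h i) \<Longrightarrow> fun_mat I J g = fun_mat I J h"
  by (auto simp: fun_mat_def intro: mat_cong)

text \<open>Identities are put in the form \<open>fun_mat\<close>, like the structural isomorphisms,
  so that coherence equations reduce to equations between functions.\<close>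

lemma Mat_simps [simp]:
  "Ob (Mat bar) = {I. finite I}"
  "Hom (Mat bar) I J = {mat I J f | f. True}"
  "TensorO (Mat bar) = pprod"
  "Unit (Mat bar) = {Star}"
  "Id (Mat bar) I = fun_mat I I (\<lambda>i. i)"
  "Assoc (Mat bar) I J L = fun_mat (pprod (pprod I J) L) (pprod I (pprod J L))
    (\<lambda>x. EPair (pfst (pfst x)) (EPair (psnd (pfst x)) (psnd x)))"
  "LUnit (Mat bar) I = fun_mat (pprod {Star} I) I psnd"
  "RUnit (Mat bar) I = fun_mat (pprod I {Star}) I pfst"
  "Swap (Mat bar) I J = fun_mat (pprod I J) (pprod J I) (\<lambda>x. EPair (psnd x) (pfst x))"
  "Mu (Mat bar) I = mat (pprod I I) I (\<lambda>x k. of_bool (pfst x = k \<and> psnd x = k))"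
  "Eta (Mat bar) I = mat {Star} I (\<lambda>_ _. 1)"
  "Delta (Mat bar) I = mat I (pprod I I) (\<lambda>i y. of_bool (pfst y = i \<and> psnd y = i))"
  "Eps (Mat bar) I = mat I {Star} (\<lambda>_ _. 1)"
  by (simp_all add: Mat_def fun_mat_def)

lemma Dag_mat: "Dag (Mat bar) (mat I J f) = mat J I (\<lambda>j i. bar (f i j))"
  by (auto simp: Mat_def intro: mat_cong)

lemma Comp_mat: "Comp (Mat bar) (mat J L g) (mat I J f) = mat I L (\<lambda>i l. \<Sum>j\<in>J. f i j * g j l)"
  by (auto simp: Mat_def intro!: mat_cong sum.cong)

lemma EPair_in_pprod [simp]: "EPair i j \<in> pprod I J \<longleftrightarrow> i \<in> I \<and> j \<in> J"
  by (auto simp: pprod_def)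

lemma pprodE:
  assumes "x \<in> pprod I J"
  obtains i j where "x = EPair i j" "i \<in> I" "j \<in> J"
  using assms by (auto simp: pprod_def)

lemma finite_pprod: "finite I \<Longrightarrow> finite J \<Longrightarrow> finite (pprod I J)"
proof -
  have "pprod I J = (\<lambda>(i, j). EPair i j) ` (I \<times> J)"
    by (auto simp: pprod_def)
  then show "finite I \<Longrightarrow> finite J \<Longrightarrow> finite (pprod I J)"
    by simp
qed

lemma TensorM_mat:
  "TensorM (Mat bar) (mat I J f) (mat I' J' g) =
    mat (pprod I I') (pprod J J') (\<lambda>x y. f (pfst x) (pfst y) * g (psnd x) (psnd y))"
  by (auto simp: Mat_def elim!: pprodE intro: mat_cong)

lemma TensorM_fun_mat:
  "TensorM (Mat bar) (fun_mat I J f) (fun_mat I' J' g) =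
    fun_mat (pprod I I') (pprod J J') (\<lambda>x. EPair (f (pfst x)) (g (psnd x)))"
  unfolding fun_mat_def TensorM_mat by (auto elim!: pprodE intro!: mat_cong)

lemma Comp_mat_fun_mat:
  assumes "finite J" "\<And>i. i \<in> I \<Longrightarrow> h i \<in> J"
  shows "Comp (Mat bar) (mat J L g) (fun_mat I J h) = mat I L (\<lambda>i l. g (h i) l)"
  unfolding fun_mat_def Comp_mat using assms by (intro mat_cong sum_of_bool_eq) auto

text \<open>Postcomposing with a bijection reindexes the columns along its inverse \<open>k\<close>,
  since \<open>h j = l\<close> selects \<open>j = k l\<close>.\<close>

lemma Comp_fun_mat_mat:
  assumes "finite J" "\<And>j. j \<in> J \<Longrightarrow> k (h j) = j" "\<And>l. l \<in> L \<Longrightarrow> k l \<in> J \<and> h (k l) = l"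
  shows "Comp (Mat bar) (fun_mat J L h) (mat I J f) = mat I L (\<lambda>i l. f i (k l))"
  unfolding fun_mat_def Comp_mat
proof (rule mat_cong)
  fix i l assume "l \<in> L"
  then have "(\<Sum>j\<in>J. f i j * of_bool (h j = l)) = (\<Sum>j\<in>J. f i j * of_bool (k l = j))"
    using assms by (intro sum.cong) (auto simp: of_bool_def)
  also have "\<dots> = f i (k l)"
    using assms \<open>l \<in> L\<close> by (intro sum_of_bool_eq) auto
  finally show "(\<Sum>j\<in>J. f i j * of_bool (h j = l)) = f i (k l)" .
qed

lemma Comp_fun_mat_fun_mat:
  assumes "finite J" "\<And>i. i \<in> I \<Longrightarrow> g i \<in> J"
  shows "Comp (Mat bar) (fun_mat J L h) (fun_mat I J g) = fun_mat I L (\<lambda>i. h (g i))"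
  using assms Comp_mat_fun_mat[OF assms] by (simp add: fun_mat_def[of J L] fun_mat_def[of I L])

lemma is_iso_fun_mat:
  assumes "finite I" "finite J" and "\<And>i. i \<in> I \<Longrightarrow> h i \<in> J \<and> k (h i) = i"
    and "\<And>j. j \<in> J \<Longrightarrow> k j \<in> I \<and> h (k j) = j"
  shows "is_iso (Mat bar) I J (fun_mat I J h)"
  unfolding is_iso_def
proof (intro conjI bexI[where x = "fun_mat J I k"])
  show "fun_mat I J h \<in> Hom (Mat bar) I J" "fun_mat J I k \<in> Hom (Mat bar) J I"
    by (auto simp: fun_mat_def)
  show "Comp (Mat bar) (fun_mat J I k) (fun_mat I J h) = Id (Mat bar) I"
    "Comp (Mat bar) (fun_mat I J h) (fun_mat J I k) = Id (Mat bar) J"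
    using assms by (auto simp: Comp_fun_mat_fun_mat intro: fun_mat_cong)
qed

lemma Dot_simps [simp]:
  "Ob (Dot S) = lists (Obj S)"
  "Id (Dot S) = dot_id S"
  "Comp (Dot S) = dot_comp S"
  "TensorO (Dot S) = (@)"
  "TensorM (Dot S) = dot_tensor S"
  "Unit (Dot S) = []"
  "Assoc (Dot S) u v w = dot_id S (u @ v @ w)"
  "LUnit (Dot S) = dot_id S"
  "RUnit (Dot S) = dot_id S"
  "Swap (Dot S) = dot_swap S"
  "Dag (Dot S) = dot_dag S"
  "Mu (Dot S) = dot_mu S"
  "Eta (Dot S) = dot_eta S"
  "Delta (Dot S) = dot_delta S"
  "Eps (Dot S) = dot_eps S"
  by (simp_all add: Dot_def)

section \<open>The functor of a matrix model\<close>

text \<open>Words of colours as right-nested pairs ending in \<open>Star\<close>. The empty word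
  becomes \<open>Star\<close>, so the unit object is sent exactly to the unit object of
  \<open>Mat\<close>.\<close>

primrec enc :: "'i elt list \<Rightarrow> 'i elt" where
  "enc [] = Star"
| "enc (x # xs) = EPair x (enc xs)"

text \<open>Left inverse of \<open>enc\<close>; the value at \<open>Atom\<close> is a mere
  default.\<close>

primrec dec :: "'i elt \<Rightarrow> 'i elt list" where
  "dec (Atom a) = []"
| "dec Star = []"
| "dec (EPair x y) = x # dec y"

lemma dec_enc [simp]: "dec (enc xs) = xs"
  by (induction xs) auto

lemma enc_eq_iff [simp]: "enc xs = enc ys \<longleftrightarrow> xs = ys"
  by (metis dec_enc)

text \<open>The free data of a functor out of \<open>Dot S\<close>: a finite set for each letter and
  a matrix for each box label, linked only by the dagger.\<close>

locale dagger_model = dagger_signature S + nontrivial_involution bar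
  for S :: "('o, 'm) signature" and bar :: "'k::field \<Rightarrow> 'k" +
  fixes X :: "'o \<Rightarrow> 'i elt set" and M :: "'m \<Rightarrow> 'i elt list \<Rightarrow> 'i elt list \<Rightarrow> 'k"
  assumes finite_X: "a \<in> Obj S \<Longrightarrow> finite (X a)"
    and M_dag: "f \<in> Mor S \<Longrightarrow> M (sdag S f) js is = bar (M f is js)"
begin

lemma bar_zero: "bar 0 = 0"
  by (metis add_cancel_right_left bar_add)

lemma finite_tups_Obj: "w \<in> lists (Obj S) \<Longrightarrow> finite (tups X w)"
  by (auto intro: finite_tups finite_X)

section \<open>Classes of diagrams and the matrices they represent\<close>

definition realizes ::
  "('o, 'm, 'b, 'd) diagram \<Rightarrow> 'o list \<Rightarrow> 'o list \<Rightarrow> ('i elt list \<Rightarrow> 'i elt list \<Rightarrow> 'k) \<Rightarrow> bool" where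
  "realizes D v w P \<longleftrightarrow> dot_diagram S D \<and> diag_dom D = v \<and> diag_cod D = w \<and>
    (\<forall>is\<in>tups X v. \<forall>js\<in>tups X w. val S X M D is js = P is js)"

text \<open>Quantifying over all members of a class makes it unnecessary to show that the operations on
  diagrams respect isomorphism.\<close>

definition represents ::
  "('o, 'm) dot_class \<Rightarrow> 'o list \<Rightarrow> 'o list \<Rightarrow> ('i elt list \<Rightarrow> 'i elt list \<Rightarrow> 'k) \<Rightarrow> bool" where
  "represents Y v w P \<longleftrightarrow> Y \<noteq> {} \<and> (\<forall>D\<in>Y. realizes D v w P)"

lemma represents_lists:
  assumes "represents Y v w P"
  shows "v \<in> lists (Obj S)" and "w \<in> lists (Obj S)"
proof -
  from assms obtain D :: "('o, 'm, nat, nat) diagram"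
    where "dot_diagram S D" "diag_dom D = v" "diag_cod D = w"
    by (auto simp: represents_def realizes_def)
  then show "v \<in> lists (Obj S)" "w \<in> lists (Obj S)"
    using dot_diagram.diag_dom_lists dot_diagram.diag_cod_lists by blast+
qed

lemma represents_cong:
  assumes "represents Y v w P"
    and "\<And>is js. is \<in> tups X v \<Longrightarrow> js \<in> tups X w \<Longrightarrow> P is js = Q is js"
  shows "represents Y v w Q"
  using assms by (simp add: represents_def realizes_def)

text \<open>By invariance of state sums under isomorphism, one diagram suffices to compute the
  matrix of its class.\<close>

lemma represents_dcls:
  assumes "realizes F v w P"
  shows "represents (dcls S F) v w P"
proof -
  have "realizes D v w P" if "dot_diagram S D" "diagram_iso S D F" for D :: "('o, 'm, nat, nat) diagram"
    using assms that diag_dom_iso[OF that] val_iso[OF that, of X M] by (simp add: realizes_def)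
  moreover have "dcls S F \<noteq> {}"
    using assms dcls_nonempty[of S F] by (auto simp: realizes_def)
  ultimately show ?thesis
    by (simp add: represents_def dcls_def)
qed

lemma represents_nonempty: "represents Y v w P \<Longrightarrow> Y \<noteq> {}"
  by (simp add: represents_def)

lemma represents_UN:
  assumes "Y \<noteq> {}" and "\<And>D. D \<in> Y \<Longrightarrow> represents (h D) v w P"
  shows "represents (\<Union>D\<in>Y. h D) v w P"
  using assms unfolding represents_def by (simp add: ex_in_conv[symmetric])

lemma represents_comp:
  assumes "represents Y v w P" and "represents Z w u Q"
  shows "represents (dot_comp S Z Y) v u (\<lambda>is ks. \<Sum>js\<in>tups X w. P is js * Q js ks)"
  unfolding dot_comp_def
proof (intro represents_UN represents_dcls)
  fix F G assume "F \<in> Y" "G \<in> Z"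
  with assms have F: "realizes F v w P" and G: "realizes G w u Q"
    by (simp_all add: represents_def)
  then interpret composable S F G
    by (simp add: composable_def composable_axioms_def realizes_def)
  show "realizes (diag_comp G F) v u (\<lambda>is ks. \<Sum>js\<in>tups X w. P is js * Q js ks)"
    using F G
    by (simp add: realizes_def dot_diagram_comp diag_dom_comp diag_cod_comp val_comp finite_X)
qed (use assms represents_nonempty in blast)+

lemma represents_tensor:
  assumes "represents Y v w P" and "represents Z v' w' Q"
  shows "represents (dot_tensor S Y Z) (v @ v') (w @ w') (\<lambda>is js.
    P (take (length v) is) (take (length w) js) * Q (drop (length v) is) (drop (length w) js))"
    (is "represents _ _ _ ?R")
  unfolding dot_tensor_def
proof (intro represents_UN represents_dcls)
  fix F G assume "F \<in> Y" "G \<in> Z"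
  with assms have F: "realizes F v w P" and G: "realizes G v' w' Q"
    by (simp_all add: represents_def)
  then have "n_in F = length v" "n_out F = length w"
    by (auto simp: realizes_def)
  with F G show "realizes (diag_tensor F G) (v @ v') (w @ w') ?R"
    by (simp add: realizes_def dot_diagram_tensor val_tensor take_drop_tups)
qed (use assms represents_nonempty in blast)+

lemma represents_dag:
  assumes "represents Y v w P"
  shows "represents (dot_dag S Y) w v (\<lambda>js is. bar (P is js))"
  unfolding dot_dag_def
proof (intro represents_UN represents_dcls)
  fix F assume "F \<in> Y"
  with assms have F: "realizes F v w P"
    by (simp add: represents_def)
  then have D: "dot_diagram S F"
    by (simp add: realizes_def)
  from F show "realizes (diag_dag S F) w v (\<lambda>js is. bar (P is js))"
    using val_dag[where M = M, OF dagger_signature_axioms D bar_zero bar_one bar_add bar_mult M_dag]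
    by (auto simp: realizes_def dot_diagram_dag dagger_signature_axioms)
qed (use assms represents_nonempty in blast)+

section \<open>Identities, swaps and spiders\<close>

lemma represents_perm:
  assumes w: "w \<in> lists (Obj S)" and g: "\<And>j. j < n \<Longrightarrow> g j < length w"
  shows "represents (dcls S (box_free w (length w) n (\<lambda>i. i) g)) w (map (\<lambda>j. w ! g j) [0..<n])
    (\<lambda>is js. of_bool (js = map (\<lambda>j. is ! g j) [0..<n]))"
proof (intro represents_dcls)
  have "dot_diagram S (box_free w (length w) n (\<lambda>i. i) g)"
    using w g by (intro dot_diagram_box_free) simp_all
  moreover have "val S X M (box_free w (length w) n (\<lambda>i. i) g) is js =
      of_bool (js = map (\<lambda>j. is ! g j) [0..<n])" if "is \<in> tups X w" for "is" js
    using w by (intro val_box_free_perm that g) (auto intro: finite_X)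
  ultimately show "realizes (box_free w (length w) n (\<lambda>i. i) g) w (map (\<lambda>j. w ! g j) [0..<n])
      (\<lambda>is js. of_bool (js = map (\<lambda>j. is ! g j) [0..<n]))"
    by (simp add: realizes_def diag_dom_box_free diag_cod_box_free map_nth)
qed

lemma represents_id:
  assumes "w \<in> lists (Obj S)"
  shows "represents (dot_id S w) w w (\<lambda>is js. of_bool (js = is))"
proof -
  have "represents (dot_id S w) w w (\<lambda>is js. of_bool (js = map (\<lambda>j. is ! j) [0..<length w]))"
    using represents_perm[of w "length w" "\<lambda>j. j"] assms
    by (simp add: dot_id_def diag_id_def map_nth)
  then show ?thesis
    by (rule represents_cong) (metis length_tups map_nth)
qed

lemma represents_swap:
  assumes "v \<in> lists (Obj S)" "w \<in> lists (Obj S)"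
  shows "represents (dot_swap S v w) (v @ w) (w @ v)
    (\<lambda>is js. of_bool (js = drop (length v) is @ take (length v) is))"
proof -
  let ?g = "\<lambda>j. if j < length w then length v + j else j - length w"
  \<comment> \<open>Reading a word through the wiring of \<open>diag_swap\<close> exchanges its two
    blocks. The claim is polymorphic, since it is used both for words of letters and for words of
    colours.\<close>
  have perm: "map (\<lambda>j. (xs @ ys) ! ?g j) [0..<length w + length v] = ys @ xs"
    if "length xs = length v" "length ys = length w" for xs ys :: "'z list"
    using that by (intro nth_equalityI) (auto simp: nth_append)
  have "?g j < length (v @ w)" if "j < length w + length v" for j
    using that by auto
  then have "represents (dot_swap S v w) (v @ w) (w @ v)
      (\<lambda>is js. of_bool (js = map (\<lambda>j. is ! ?g j) [0..<length w + length v]))"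
    using represents_perm[of "v @ w" "length w + length v" ?g, unfolded perm[OF refl refl]] assms
    by (simp add: dot_swap_def diag_swap_def)
  then show ?thesis
    by (rule represents_cong) (auto elim!: append_tupsE simp: perm length_tups)
qed

lemma represents_spider:
  assumes "a \<in> Obj S"
  shows "represents (dcls S (diag_spider a m n)) (replicate m a) (replicate n a)
    (\<lambda>is js. \<Sum>c\<in>X a. of_bool (is = replicate m c \<and> js = replicate n c))"
proof (intro represents_dcls)
  have "dot_diagram S (diag_spider a m n)"
    unfolding diag_spider_def using assms by (intro dot_diagram_box_free) auto
  then show "realizes (diag_spider a m n) (replicate m a) (replicate n a)
    (\<lambda>is js. \<Sum>c\<in>X a. of_bool (is = replicate m c \<and> js = replicate n c))"
    by (simp add: realizes_def val_spider)
      (simp add: diag_spider_def diag_dom_box_free diag_cod_box_free map_replicate_const)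
qed

text \<open>When the first factor is the matrix of a function, the sum over intermediate words
  collapses to the single word \<open>\<pi> is\<close>, and composition is substitution.\<close>

lemma represents_comp_fun:
  assumes Y: "represents Y v w (\<lambda>is ks. of_bool (ks = \<pi> is))" and Z: "represents Z w u Q"
    and \<pi>: "\<And>is. is \<in> tups X v \<Longrightarrow> \<pi> is \<in> tups X w"
  shows "represents (dot_comp S Z Y) v u (\<lambda>is js. Q (\<pi> is) js)"
  using represents_comp[OF Y Z]
proof (rule represents_cong)
  fix "is" js assume "is \<in> tups X v"
  then show "(\<Sum>ks\<in>tups X w. of_bool (ks = \<pi> is) * Q ks js) = Q (\<pi> is) js"
    using represents_lists(1)[OF Z] by (intro sum_of_bool_eq finite_tups_Obj \<pi>)
qed

lemma tups_ConsE:
  assumes "is \<in> tups X (a # w)"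
  obtains x xs where "is = x # xs" "x \<in> X a" "xs \<in> tups X w" "length xs = length w"
  using assms length_tups[of _ X w] by (auto simp: tups_Cons)

lemma tups_mu_domE:
  assumes "is \<in> tups X (a # w @ a # w)"
  obtains x y xs ys where "is = x # xs @ y # ys" "x \<in> X a" "y \<in> X a" "xs \<in> tups X w"
    "ys \<in> tups X w" "length xs = length w" "length ys = length w"
proof -
  from assms obtain x zs where "is = x # zs" "x \<in> X a" "zs \<in> tups X (w @ a # w)"
    by (auto simp: tups_Cons)
  moreover from this(3) obtain xs zs' where "zs = xs @ zs'" "xs \<in> tups X w"
    "zs' \<in> tups X (a # w)" "length xs = length w"
    by (rule append_tupsE)
  moreover from this(3) obtain y ys where "zs' = y # ys" "y \<in> X a" "ys \<in> tups X w"
    by (auto simp: tups_Cons)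
  ultimately show ?thesis
    using that length_tups by blast
qed

lemma tups_mu_middleE:
  assumes "is \<in> tups X (a # a # w @ w)"
  obtains x y xs ys where "is = x # y # xs @ ys" "x \<in> X a" "y \<in> X a" "xs \<in> tups X w"
    "ys \<in> tups X w" "length xs = length w" "length ys = length w"
proof -
  from assms obtain x y zs where "is = x # y # zs" "x \<in> X a" "y \<in> X a" "zs \<in> tups X (w @ w)"
    by (auto simp: tups_Cons)
  moreover from this(4) obtain xs ys where "zs = xs @ ys" "xs \<in> tups X w"
    "ys \<in> tups X w" "length xs = length w"
    by (rule append_tupsE)
  ultimately show ?thesis
    using that length_tups by blast
qed

section \<open>The Frobenius structure on words\<close>

text \<open>The rearrangement of \<open>x xs y ys\<close> into \<open>x y xs ys\<close> that
  precedes multiplication: \<open>y\<close> sits at position \<open>Suc (length w)\<close> and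
  \<open>ys\<close> starts one later.\<close>

lemma represents_mu_shuffle:
  assumes "a # w \<in> lists (Obj S)"
  shows "represents (dot_tensor S (dot_tensor S (dot_id S [a]) (dot_swap S w [a])) (dot_id S w))
    (a # w @ a # w) (a # a # w @ w) (\<lambda>is ks. of_bool (ks = is ! 0 # is ! Suc (length w)
      # take (length w) (drop 1 is) @ drop (Suc (Suc (length w))) is))"
proof -
  have a: "[a] \<in> lists (Obj S)" and w: "w \<in> lists (Obj S)"
    using assms by auto
  note rep = represents_tensor[OF represents_tensor[OF represents_id[OF a] represents_swap[OF w a]]
      represents_id[OF w], unfolded append_Cons append_Nil append_assoc]
  show ?thesis
    using rep
    by (rule represents_cong) (auto elim!: tups_mu_domE tups_mu_middleE simp: nth_append)
qed

text \<open>The opposite rearrangement, of \<open>x y xs ys\<close> into \<open>x xs y ys\<close>,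
  needed after comultiplication.\<close>

lemma represents_delta_shuffle:
  assumes "a # w \<in> lists (Obj S)"
  shows "represents (dot_tensor S (dot_tensor S (dot_id S [a]) (dot_swap S [a] w)) (dot_id S w))
    (a # a # w @ w) (a # w @ a # w) (\<lambda>is ks. of_bool (ks = is ! 0 #
      take (length w) (drop 2 is) @ is ! 1 # drop (Suc (Suc (length w))) is))"
proof -
  have a: "[a] \<in> lists (Obj S)" and w: "w \<in> lists (Obj S)"
    using assms by auto
  note rep = represents_tensor[OF represents_tensor[OF represents_id[OF a] represents_swap[OF a w]]
      represents_id[OF w], unfolded append_Cons append_Nil append_assoc]
  show ?thesis
    using rep
    by (rule represents_cong) (auto elim!: tups_mu_domE tups_mu_middleE simp: nth_append)
qed

text \<open>The colour of the dot is forced by \<open>js\<close>. Writing the result as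
  \<open>is = js @ js\<close> gives letters the same formula that \<open>represents_mu\<close> has
  for words.\<close>

lemma represents_spider_mu:
  assumes "a \<in> Obj S"
  shows "represents (dcls S (diag_spider a 2 1)) [a, a] [a] (\<lambda>is js. of_bool (is = js @ js))"
  using represents_spider[OF assms, of 2 1] unfolding numeral_2_eq_2 One_nat_def replicate.simps
proof (rule represents_cong)
  fix "is" js assume "js \<in> tups X [a]"
  then obtain z where z: "js = [z]" "z \<in> X a"
    by (auto simp: tups_Cons)
  have "(\<Sum>c\<in>X a. of_bool (is = [c, c] \<and> js = [c]))
      = (\<Sum>c\<in>X a. of_bool (z = c) * of_bool (is = [c, c]) :: 'k)"
    using z by (intro sum.cong) auto
  also have "\<dots> = of_bool (is = js @ js)"
    using z assms by (simp add: sum_of_bool_eq finite_X del: sum_of_bool_mult_eq)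
  finally show "(\<Sum>c\<in>X a. of_bool (is = [c, c] \<and> js = [c])) = (of_bool (is = js @ js) :: 'k)" .
qed

lemma represents_spider_delta:
  assumes "a \<in> Obj S"
  shows "represents (dcls S (diag_spider a 1 2)) [a] [a, a] (\<lambda>is js. of_bool (js = is @ is))"
  using represents_spider[OF assms, of 1 2] unfolding numeral_2_eq_2 One_nat_def replicate.simps
proof (rule represents_cong)
  fix "is" js assume "is \<in> tups X [a]"
  then obtain z where z: "is = [z]" "z \<in> X a"
    by (auto simp: tups_Cons)
  have "(\<Sum>c\<in>X a. of_bool (is = [c] \<and> js = [c, c]))
      = (\<Sum>c\<in>X a. of_bool (z = c) * of_bool (js = [c, c]) :: 'k)"
    using z by (intro sum.cong) auto
  also have "\<dots> = of_bool (js = is @ is)"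
    using z assms by (simp add: sum_of_bool_eq finite_X del: sum_of_bool_mult_eq)
  finally show "(\<Sum>c\<in>X a. of_bool (is = [c] \<and> js = [c, c])) = (of_bool (js = is @ is) :: 'k)" .
qed

lemma represents_spider_eta:
  assumes "a \<in> Obj S"
  shows "represents (dcls S (diag_spider a 0 1)) [] [a] (\<lambda>is js. 1)"
  using represents_spider[OF assms, of 0 1] unfolding One_nat_def replicate.simps
proof (rule represents_cong)
  fix "is" js assume "is \<in> tups X []" "js \<in> tups X [a]"
  then obtain z where z: "is = []" "js = [z]" "z \<in> X a"
    by (auto simp: tups_Cons)
  have "(\<Sum>c\<in>X a. of_bool (is = [] \<and> js = [c])) = (\<Sum>c\<in>X a. of_bool (z = c) * 1 :: 'k)"
    using z by (intro sum.cong) auto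
  also have "\<dots> = 1"
    using z assms by (intro sum_of_bool_eq finite_X)
  finally show "(\<Sum>c\<in>X a. of_bool (is = [] \<and> js = [c])) = (1 :: 'k)" .
qed

lemma represents_spider_eps:
  assumes "a \<in> Obj S"
  shows "represents (dcls S (diag_spider a 1 0)) [a] [] (\<lambda>is js. 1)"
  using represents_spider[OF assms, of 1 0] unfolding One_nat_def replicate.simps
proof (rule represents_cong)
  fix "is" js assume "is \<in> tups X [a]" "js \<in> tups X []"
  then obtain z where z: "is = [z]" "js = []" "z \<in> X a"
    by (auto simp: tups_Cons)
  have "(\<Sum>c\<in>X a. of_bool (is = [c] \<and> js = [])) = (\<Sum>c\<in>X a. of_bool (z = c) * 1 :: 'k)"
    using z by (intro sum.cong) auto
  also have "\<dots> = 1"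
    using z assms by (intro sum_of_bool_eq finite_X)
  finally show "(\<Sum>c\<in>X a. of_bool (is = [c] \<and> js = [])) = (1 :: 'k)" .
qed

text \<open>Induction on the word: after the shuffle, the first letters and the remaining words are
  compared separately, and together these comparisons say that the two halves of \<open>is\<close>
  both equal \<open>js\<close>.\<close>

lemma represents_mu:
  assumes "w \<in> lists (Obj S)"
  shows "represents (dot_mu S w) (w @ w) w (\<lambda>is js. of_bool (is = js @ js))"
  using assms
proof (induction w rule: list.induct)
  case Nil
  show ?case
    using represents_id[of "[]"] by (auto intro: represents_cong)
next
  case (Cons a w)
  then have a: "a \<in> Obj S" and w: "w \<in> lists (Obj S)" by auto
  have spider: "represents (dot_tensor S (dcls S (diag_spider a 2 1)) (dot_mu S w))
      (a # a # w @ w) (a # w) (\<lambda>is js. of_bool (take 2 is = take 1 js @ take 1 js)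
        * of_bool (drop 2 is = drop 1 js @ drop 1 js))"
    using represents_tensor[OF represents_spider_mu[OF a] Cons.IH[OF w]]
    by (simp add: numeral_2_eq_2)
  show ?case
    unfolding dot_mu.simps append_Cons
  proof (rule represents_cong[OF represents_comp_fun[OF represents_mu_shuffle[OF Cons.prems] spider]])
    fix "is" js assume "is \<in> tups X (a # w @ a # w)"
    then obtain x y xs ys where "is = x # xs @ y # ys" "x \<in> X a" "y \<in> X a" "xs \<in> tups X w"
      "ys \<in> tups X w" "length xs = length w" "length ys = length w"
      by (rule tups_mu_domE)
    then show "is ! 0 # is ! Suc (length w) # take (length w) (drop 1 is)
        @ drop (Suc (Suc (length w))) is \<in> tups X (a # a # w @ w)"
      by (simp add: nth_append append_in_tups)
  next
    fix "is" js assume "is \<in> tups X (a # w @ a # w)" "js \<in> tups X (a # w)"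
    from this(2) obtain z zs where "js = z # zs" "length zs = length w"
      by (rule tups_ConsE)
    with \<open>is \<in> _\<close> show "of_bool (take 2 (is ! 0 # is ! Suc (length w) # take (length w) (drop 1 is)
        @ drop (Suc (Suc (length w))) is) = take 1 js @ take 1 js)
      * of_bool (drop 2 (is ! 0 # is ! Suc (length w) # take (length w) (drop 1 is)
        @ drop (Suc (Suc (length w))) is) = drop 1 js @ drop 1 js)
      = (of_bool (is = js @ js) :: 'k)"
      by (auto elim!: tups_mu_domE simp: nth_append)
  qed
qed

text \<open>Dual to \<open>represents_mu\<close>, with the shuffle applied last; both factors are
  matrices of functions, and the composite duplicates the word.\<close>

lemma represents_delta:
  assumes "w \<in> lists (Obj S)"
  shows "represents (dot_delta S w) w (w @ w) (\<lambda>is js. of_bool (js = is @ is))"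
  using assms
proof (induction w rule: list.induct)
  case Nil
  show ?case
    using represents_id[of "[]"] by (auto intro: represents_cong)
next
  case (Cons a w)
  then have a: "a \<in> Obj S" and w: "w \<in> lists (Obj S)" by auto
  have "represents (dot_tensor S (dcls S (diag_spider a 1 2)) (dot_delta S w))
      (a # w) (a # a # w @ w) (\<lambda>is js. of_bool (take 2 js = take 1 is @ take 1 is)
        * of_bool (drop 2 js = drop 1 is @ drop 1 is))"
    using represents_tensor[OF represents_spider_delta[OF a] Cons.IH[OF w]]
    by (simp add: numeral_2_eq_2)
  \<comment> \<open>Rewritten as the matrix of a function, as \<open>represents_comp_fun\<close>
    requires of the factor applied first.\<close>
  then have spider: "represents (dot_tensor S (dcls S (diag_spider a 1 2)) (dot_delta S w))
      (a # w) (a # a # w @ w) (\<lambda>is js. of_bool (js = hd is # hd is # tl is @ tl is))"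
    by (rule represents_cong) (auto elim!: tups_mu_middleE simp: tups_Cons)
  show ?case
    unfolding dot_delta.simps append_Cons
  proof (rule represents_cong[OF represents_comp_fun[OF spider represents_delta_shuffle[OF Cons.prems]]])
    fix "is" assume "is \<in> tups X (a # w)"
    then show "hd is # hd is # tl is @ tl is \<in> tups X (a # a # w @ w)"
      by (auto elim!: tups_ConsE simp: append_in_tups)
  next
    fix "is" js assume "is \<in> tups X (a # w)"
    then show "of_bool (js = (hd is # hd is # tl is @ tl is) ! 0 #
          take (length w) (drop 2 (hd is # hd is # tl is @ tl is)) @
          (hd is # hd is # tl is @ tl is) ! 1 #
          drop (Suc (Suc (length w))) (hd is # hd is # tl is @ tl is))
      = (of_bool (js = is @ is) :: 'k)"
      by (auto elim!: tups_ConsE)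
  qed
qed

lemma represents_eta:
  assumes "w \<in> lists (Obj S)"
  shows "represents (dot_eta S w) [] w (\<lambda>is js. 1)"
  using assms
proof (induction w rule: list.induct)
  case Nil
  show ?case
    using represents_id[of "[]"] by (auto intro: represents_cong)
next
  case (Cons a w)
  then show ?case
    using represents_tensor[OF represents_spider_eta, of a "dot_eta S w" "[]" w "\<lambda>is js. 1"] by simp
qed

lemma represents_eps:
  assumes "w \<in> lists (Obj S)"
  shows "represents (dot_eps S w) w [] (\<lambda>is js. 1)"
  using assms
proof (induction w rule: list.induct)
  case Nil
  show ?case
    using represents_id[of "[]"] by (auto intro: represents_cong)
next
  case (Cons a w)
  then show ?case
    using represents_tensor[OF represents_spider_eps, of a "dot_eps S w" w "[]" "\<lambda>is js. 1"] by simp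
qed

section \<open>Objects, morphisms and comparison maps of the functor\<close>

definition obj :: "'o list \<Rightarrow> 'i elt set" where
  "obj w = enc ` tups X w"

definition matr :: "'o list \<Rightarrow> 'o list \<Rightarrow> ('i elt list \<Rightarrow> 'i elt list \<Rightarrow> 'k) \<Rightarrow> ('i, 'k) matrix" where
  "matr v w P = mat (obj v) (obj w) (\<lambda>i j. P (dec i) (dec j))"

text \<open>The choice of representative is harmless: all members of a class that represents a
  matrix yield that matrix, see \<open>mor_represents\<close>.\<close>

definition mor :: "('o, 'm) dot_class \<Rightarrow> ('i, 'k) matrix" where
  "mor Y = (let D = (SOME D. D \<in> Y) in matr (diag_dom D) (diag_cod D) (val S X M D))"

text \<open>The comparison from \<open>obj (v @ w)\<close> to \<open>pprod (obj v) (obj w)\<close>: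
  an encoded word is cut after \<open>length v\<close> letters. Its inverse is
  \<open>join_words\<close>.\<close>

definition split_word :: "'o list \<Rightarrow> 'i elt \<Rightarrow> 'i elt" where
  "split_word v x = EPair (enc (take (length v) (dec x))) (enc (drop (length v) (dec x)))"

definition join_words :: "'i elt \<Rightarrow> 'i elt" where
  "join_words x = enc (dec (pfst x) @ dec (psnd x))"

definition model_functor ::
  "('o list, ('o, 'm) dot_class, 'i elt set, ('i, 'k) matrix) functor_data" where
  "model_functor =
    \<lparr>FO = obj, FM = mor,
     FP = (\<lambda>v w. fun_mat (obj (v @ w)) (pprod (obj v) (obj w)) (split_word v)),
     FU = fun_mat {Star} {Star} (\<lambda>x. x)\<rparr>"

lemma finite_obj: "w \<in> lists (Obj S) \<Longrightarrow> finite (obj w)"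
  by (simp add: obj_def finite_tups_Obj)

lemma obj_Nil [simp]: "obj [] = {Star}"
  by (simp add: obj_def)

lemma matr_cong:
  "(\<And>is js. is \<in> tups X v \<Longrightarrow> js \<in> tups X w \<Longrightarrow> P is js = Q is js) \<Longrightarrow> matr v w P = matr v w Q"
  unfolding matr_def by (rule mat_cong) (auto simp: obj_def)

lemma mor_represents:
  assumes "represents Y v w P"
  shows "mor Y = matr v w P"
proof -
  have "(SOME D. D \<in> Y) \<in> Y"
    using represents_nonempty[OF assms] by (simp add: some_in_eq)
  then have "realizes (SOME D. D \<in> Y) v w P"
    using assms by (simp add: represents_def)
  then show ?thesis
    by (auto simp: mor_def Let_def realizes_def intro: matr_cong)
qed

text \<open>Every morphism of \<open>Dot S\<close> represents some matrix, so the functor laws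
  reduce to calculations with representing functions.\<close>

lemma represents_Hom:
  assumes "Y \<in> Hom (Dot S) v w"
  obtains P where "represents Y v w P"
proof -
  from assms obtain F :: "('o, 'm, nat, nat) diagram"
    where "Y = dcls S F" "dot_diagram S F" "diag_dom F = v" "diag_cod F = w"
    by (auto simp: Dot_def)
  then have "represents Y v w (val S X M F)"
    by (auto intro: represents_dcls simp: realizes_def)
  with that show ?thesis by blast
qed

lemma Comp_matr:
  "Comp (Mat bar) (matr w u Q) (matr v w P) = matr v u (\<lambda>is ks. \<Sum>js\<in>tups X w. P is js * Q js ks)"
  unfolding matr_def Comp_mat
  by (rule mat_cong) (simp add: obj_def sum.reindex inj_on_def)

lemma matr_fun: "matr v w (\<lambda>is js. of_bool (js = \<pi> is)) = fun_mat (obj v) (obj w) (\<lambda>x. enc (\<pi> (dec x)))"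
  unfolding matr_def fun_mat_def by (rule mat_cong) (auto simp: obj_def)

lemma split_word_obj:
  assumes "x \<in> obj (v @ w)"
  shows "split_word v x \<in> pprod (obj v) (obj w)" and "join_words (split_word v x) = x"
  using assms by (auto simp: obj_def split_word_def join_words_def take_drop_tups)

lemma join_words_obj:
  assumes "y \<in> pprod (obj v) (obj w)"
  shows "join_words y \<in> obj (v @ w)" and "split_word v (join_words y) = y"
  using assms by (auto simp: obj_def split_word_def join_words_def append_in_tups length_tups elim!: pprodE)

lemma mor_id: "w \<in> lists (Obj S) \<Longrightarrow> mor (dot_id S w) = fun_mat (obj w) (obj w) (\<lambda>x. x)"
  by (subst mor_represents[OF represents_id])
    (auto simp: matr_fun obj_def intro: fun_mat_cong)

text \<open>Cutting is bijective with inverse \<open>join_words\<close>, so this composite only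
  reindexes columns by concatenation.\<close>

lemma Comp_split_word_matr:
  assumes "v \<in> lists (Obj S)" "w \<in> lists (Obj S)"
  shows "Comp (Mat bar) (fun_mat (obj (v @ w)) (pprod (obj v) (obj w)) (split_word v)) (matr u (v @ w) P)
    = mat (obj u) (pprod (obj v) (obj w)) (\<lambda>x y. P (dec x) (dec (pfst y) @ dec (psnd y)))"
proof -
  have "Comp (Mat bar) (fun_mat (obj (v @ w)) (pprod (obj v) (obj w)) (split_word v)) (matr u (v @ w) P)
    = mat (obj u) (pprod (obj v) (obj w)) (\<lambda>x y. P (dec x) (dec (join_words y)))"
    unfolding matr_def
    by (rule Comp_fun_mat_mat) (use assms in \<open>auto simp: finite_obj split_word_obj join_words_obj\<close>)
  then show ?thesis
    by (simp add: join_words_def)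
qed

lemma objE:
  assumes "x \<in> obj (v @ w)"
  obtains xs ys where "x = enc (xs @ ys)" "xs \<in> tups X v" "ys \<in> tups X w"
    "length xs = length v" "length ys = length w"
  using assms by (auto simp: obj_def length_tups elim!: append_tupsE)

lemma mor_Hom: "f \<in> Hom (Dot S) v w \<Longrightarrow> mor f \<in> Hom (Mat bar) (obj v) (obj w)"
  by (auto elim!: represents_Hom simp: mor_represents matr_def)

lemma mor_comp:
  assumes "f \<in> Hom (Dot S) u v" "g \<in> Hom (Dot S) v w"
  shows "mor (dot_comp S g f) = Comp (Mat bar) (mor g) (mor f)"
proof -
  obtain P Q where "represents f u v P" "represents g v w Q"
    using assms by (elim represents_Hom)
  then show ?thesis
    by (simp add: mor_represents mor_represents[OF represents_comp] Comp_matr)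
qed

lemma mor_dag: "f \<in> Hom (Dot S) v w \<Longrightarrow> mor (dot_dag S f) = Dag (Mat bar) (mor f)"
  by (auto elim!: represents_Hom simp: mor_represents mor_represents[OF represents_dag] matr_def Dag_mat)

section \<open>Naturality and coherence of the comparison maps\<close>

abbreviation fp :: "'o list \<Rightarrow> 'o list \<Rightarrow> ('i, 'k) matrix" where
  "fp v w \<equiv> fun_mat (obj (v @ w)) (pprod (obj v) (obj w)) (split_word v)"

lemma fp_iso:
  assumes "v \<in> lists (Obj S)" "w \<in> lists (Obj S)"
  shows "is_iso (Mat bar) (obj (v @ w)) (pprod (obj v) (obj w)) (fp v w)"
  using assms
  by (intro is_iso_fun_mat[where k = join_words] conjI finite_obj finite_pprod split_word_obj join_words_obj) simp_all

lemma fp_natural: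
  assumes Ob: "v \<in> lists (Obj S)" "w \<in> lists (Obj S)" "v' \<in> lists (Obj S)" "w' \<in> lists (Obj S)"
    and f: "f \<in> Hom (Dot S) v v'" and g: "g \<in> Hom (Dot S) w w'"
  shows "Comp (Mat bar) (TensorM (Mat bar) (mor f) (mor g)) (fp v w) =
    Comp (Mat bar) (fp v' w') (mor (dot_tensor S f g))"
proof -
  obtain P Q where P: "represents f v v' P" and Q: "represents g w w' Q"
    using f g by (elim represents_Hom)
  have "Comp (Mat bar) (TensorM (Mat bar) (mor f) (mor g)) (fp v w) =
      mat (obj (v @ w)) (pprod (obj v') (obj w')) (\<lambda>x y.
        P (dec (pfst (split_word v x))) (dec (pfst y)) * Q (dec (psnd (split_word v x))) (dec (psnd y)))"
    unfolding mor_represents[OF P] mor_represents[OF Q] matr_def TensorM_mat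
    by (rule Comp_mat_fun_mat) (use Ob in \<open>simp_all add: split_word_obj finite_pprod finite_obj\<close>)
  moreover have "Comp (Mat bar) (fp v' w') (mor (dot_tensor S f g)) =
      mat (obj (v @ w)) (pprod (obj v') (obj w')) (\<lambda>x y.
        P (take (length v) (dec x)) (take (length v') (dec (pfst y) @ dec (psnd y))) *
        Q (drop (length v) (dec x)) (drop (length v') (dec (pfst y) @ dec (psnd y))))"
    unfolding mor_represents[OF represents_tensor[OF P Q]] by (rule Comp_split_word_matr[OF Ob(3,4)])
  ultimately show ?thesis
    by (auto simp: split_word_def obj_def length_tups elim!: pprodE intro!: mat_cong)
qed

text \<open>Both sides are matrices of functions cutting an encoded word into the same three pieces,
  once starting from the last cut and once from the first.\<close>

lemma fp_assoc:
  assumes "u \<in> lists (Obj S)" "v \<in> lists (Obj S)" "w \<in> lists (Obj S)"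
  shows "Comp (Mat bar) (Assoc (Mat bar) (obj u) (obj v) (obj w))
      (Comp (Mat bar) (TensorM (Mat bar) (fp u v) (Id (Mat bar) (obj w))) (fp (u @ v) w)) =
    Comp (Mat bar) (TensorM (Mat bar) (Id (Mat bar) (obj u)) (fp v w))
      (Comp (Mat bar) (fp u (v @ w)) (mor (dot_id S (u @ v @ w))))"
proof -
  have fin: "finite (obj (u @ v @ w))" "finite (obj (u @ v))" "finite (obj (v @ w))"
    "finite (obj u)" "finite (obj v)" "finite (obj w)"
    using assms by (simp_all add: finite_obj)
  have m1: "split_word (u @ v) x \<in> pprod (obj (u @ v)) (obj w)" if "x \<in> obj (u @ v @ w)" for x
    using that split_word_obj[of x "u @ v" w] by simp
  have m2: "split_word u x \<in> pprod (obj u) (obj (v @ w))" if "x \<in> obj (u @ v @ w)" for x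
    using that by (rule split_word_obj)
  have m3: "EPair (split_word u (pfst y)) (psnd y) \<in> pprod (pprod (obj u) (obj v)) (obj w)"
    if "y \<in> pprod (obj (u @ v)) (obj w)" for y
    using that by (auto elim!: pprodE simp: split_word_obj)
  have m4: "EPair (split_word u (pfst (split_word (u @ v) x))) (psnd (split_word (u @ v) x))
      \<in> pprod (pprod (obj u) (obj v)) (obj w)" if "x \<in> obj (u @ v @ w)" for x
    using that by (intro m3 m1)
  show ?thesis
    using assms
    by (simp add: TensorM_fun_mat mor_id Comp_fun_mat_fun_mat fin finite_pprod m1 m2 m4[simplified])
      (rule fun_mat_cong, simp add: split_word_def take_drop add.commute)
qed

lemma fp_lunit:
  assumes "w \<in> lists (Obj S)"
  shows "Comp (Mat bar) (LUnit (Mat bar) (obj w)) (Comp (Mat bar)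
    (TensorM (Mat bar) (fun_mat {Star} {Star} (\<lambda>x. x)) (Id (Mat bar) (obj w))) (fp [] w)) =
    mor (dot_id S w)"
proof -
  have eq: "split_word [] x = EPair Star x" if "x \<in> obj w" for x
    using that by (auto simp: split_word_def obj_def)
  have "split_word [] x \<in> pprod {Star} (obj w)" if "x \<in> obj w" for x
    using that by (simp add: eq)
  then show ?thesis
    using assms
    by (simp add: TensorM_fun_mat mor_id Comp_fun_mat_fun_mat finite_obj finite_pprod eq)
      (rule fun_mat_cong, simp add: eq)
qed

lemma fp_runit:
  assumes "w \<in> lists (Obj S)"
  shows "Comp (Mat bar) (RUnit (Mat bar) (obj w)) (Comp (Mat bar)
    (TensorM (Mat bar) (Id (Mat bar) (obj w)) (fun_mat {Star} {Star} (\<lambda>x. x))) (fp w [])) =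
    mor (dot_id S w)"
proof -
  have eq: "split_word w x = EPair x Star" if "x \<in> obj w" for x
    using that by (auto simp: split_word_def obj_def length_tups)
  have "split_word w x \<in> pprod (obj w) {Star}" if "x \<in> obj w" for x
    using that by (simp add: eq)
  then show ?thesis
    using assms
    by (simp add: TensorM_fun_mat mor_id Comp_fun_mat_fun_mat finite_obj finite_pprod eq)
      (rule fun_mat_cong, simp add: eq)
qed

lemma fp_swap:
  assumes "v \<in> lists (Obj S)" "w \<in> lists (Obj S)"
  shows "Comp (Mat bar) (Swap (Mat bar) (obj v) (obj w)) (fp v w) =
    Comp (Mat bar) (fp w v) (mor (dot_swap S v w))"
proof -
  let ?s = "\<lambda>x. enc (drop (length v) (dec x) @ take (length v) (dec x))"
  have "mor (dot_swap S v w) = fun_mat (obj (v @ w)) (obj (w @ v)) ?s"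
    unfolding mor_represents[OF represents_swap[OF assms]] matr_fun ..
  moreover have "?s x \<in> obj (w @ v)" if "x \<in> obj (v @ w)" for x
    using that by (rule objE) (simp add: obj_def append_in_tups)
  moreover have "EPair (psnd (split_word v x)) (pfst (split_word v x)) = split_word w (?s x)"
    if "x \<in> obj (v @ w)" for x
    using that by (rule objE) (simp add: split_word_def)
  ultimately show ?thesis
    using assms
    by (auto simp: Comp_fun_mat_fun_mat finite_obj finite_pprod split_word_obj intro!: fun_mat_cong)
qed

section \<open>Compatibility with the Frobenius structure\<close>

text \<open>Cutting a word of length \<open>2 * length w\<close> and testing both halves against
  \<open>k\<close> is the same as testing the word against \<open>k\<close> doubled.\<close>

lemma mor_mu:
  assumes "w \<in> lists (Obj S)"
  shows "mor (dot_mu S w) = Comp (Mat bar) (Mu (Mat bar) (obj w)) (fp w w)"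
proof -
  have "Comp (Mat bar) (Mu (Mat bar) (obj w)) (fp w w) = mat (obj (w @ w)) (obj w)
      (\<lambda>x k. of_bool (pfst (split_word w x) = k \<and> psnd (split_word w x) = k))"
    unfolding Mat_simps
    by (rule Comp_mat_fun_mat) (use assms in \<open>simp_all add: finite_obj finite_pprod split_word_obj\<close>)
  also have "\<dots> = matr (w @ w) w (\<lambda>is js. of_bool (is = js @ js))"
    unfolding matr_def
  proof (rule mat_cong)
    fix x k assume "x \<in> obj (w @ w)" "k \<in> obj w"
    then obtain xs ys zs where "x = enc (xs @ ys)" "length xs = length w" "length ys = length w"
      "k = enc zs" "length zs = length w"
      by (elim objE) (auto simp: obj_def length_tups)
    then show "of_bool (pfst (split_word w x) = k \<and> psnd (split_word w x) = k) =
        (of_bool (dec x = dec k @ dec k) :: 'k)"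
      by (simp add: split_word_def)
  qed
  finally show ?thesis
    using mor_represents[OF represents_mu[OF assms]] by simp
qed

lemma mor_delta:
  assumes "w \<in> lists (Obj S)"
  shows "Comp (Mat bar) (fp w w) (mor (dot_delta S w)) = Delta (Mat bar) (obj w)"
  unfolding mor_represents[OF represents_delta[OF assms]] Comp_split_word_matr[OF assms assms] Mat_simps
  by (rule mat_cong) (auto elim!: pprodE simp: obj_def length_tups)

lemma mor_eta:
  assumes "w \<in> lists (Obj S)"
  shows "mor (dot_eta S w) = Comp (Mat bar) (Eta (Mat bar) (obj w)) (fun_mat {Star} {Star} (\<lambda>x. x))"
  unfolding mor_represents[OF represents_eta[OF assms]] matr_def Mat_simps
  by (subst Comp_mat_fun_mat) simp_all

lemma mor_eps:
  assumes "w \<in> lists (Obj S)"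
  shows "Comp (Mat bar) (fun_mat {Star} {Star} (\<lambda>x. x)) (mor (dot_eps S w)) = Eps (Mat bar) (obj w)"
  unfolding mor_represents[OF represents_eps[OF assms]] matr_def Mat_simps obj_Nil
  by (subst Comp_fun_mat_mat[where k = "\<lambda>x. x"]) simp_all

lemma model_functor: "dagger_hypergraph_functor (Dot S) (Mat bar) model_functor"
proof -
  have sel [simp]: "FO model_functor = obj" "FM model_functor = mor" "FP model_functor = fp"
    "FU model_functor = fun_mat {Star} {Star} (\<lambda>x. x)"
    by (simp_all add: model_functor_def fun_eq_iff)
  have unit: "is_iso (Mat bar) {Star} {Star} (fun_mat {Star} {Star} (\<lambda>x. x))"
    by (rule is_iso_fun_mat[where k = "\<lambda>x. x"]) simp_all
  show ?thesis
    by unfold_locales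
      (simp_all only: sel Dot_simps obj_Nil Mat_simps(1,3,4) mem_Collect_eq finite_obj mor_Hom
        mor_comp mor_dag fp_iso fp_natural fp_assoc fp_lunit[unfolded obj_Nil] fp_runit[unfolded obj_Nil] fp_swap mor_mu mor_eta
        mor_delta mor_eps unit, simp_all add: mor_id)
qed

text \<open>State sums are the entries of the functor's matrices at encoded boundary words; at all
  other words both sides vanish.\<close>

lemma model_functor_dcls:
  assumes F: "dot_diagram S F" and G: "dot_diagram S G"
    and eq: "diag_dom F = diag_dom G" "diag_cod F = diag_cod G"
    and FM: "FM model_functor (dcls S F) = FM model_functor (dcls S G)"
  shows "val S X M F is js = val S X M G is js"
proof (cases "is \<in> tups X (diag_dom F) \<and> js \<in> tups X (diag_cod F)")
  case True
  have "represents (dcls S F) (diag_dom F) (diag_cod F) (val S X M F)"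
    "represents (dcls S G) (diag_dom F) (diag_cod F) (val S X M G)"
    using F G eq by (auto intro!: represents_dcls simp: realizes_def)
  from this[THEN mor_represents] FM
  have "entry (matr (diag_dom F) (diag_cod F) (val S X M F)) (enc is) (enc js) =
    entry (matr (diag_dom F) (diag_cod F) (val S X M G)) (enc is) (enc js)"
    by (simp add: model_functor_def)
  then show ?thesis
    using True by (simp add: matr_def obj_def)
next
  case False
  then show ?thesis
    using dot_diagram.val_outside[OF F] dot_diagram.val_outside[OF G] eq by metis
qed

end

section \<open>Reconstructing a diagram from its state sums\<close>

text \<open>Encoded lists of \<open>Star\<close> of different lengths are distinct. Thus any finite
  set of dots fits into \<open>'i elt\<close>, whatever the type of atoms.\<close>

lemma infinite_UNIV_elt: "infinite (UNIV :: 'i elt set)"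
proof -
  have "inj (\<lambda>n. enc (replicate n (Star :: 'i elt)))"
    by (rule injI) (metis dec_enc length_replicate)
  then show ?thesis
    using finite_subset[OF subset_UNIV] range_inj_infinite by blast
qed

lemma poly_val:
  "poly (val S X M D is js) r = val S X (\<lambda>f is js. poly (M f is js) r) D is js"
  unfolding val_def weight_def poly_sum poly_mult poly_prod
  by (intro sum.cong refl) (simp add: of_bool_def)

lemma val_scale:
  "val S X (\<lambda>f is js. c * M f is js) D is js = c ^ card (boxes D) * val S X M D is js"
  unfolding val_def weight_def by (simp add: prod.distrib sum_distrib_left mult_ac)

text \<open>With one colour there is one colouring, and each box contributes the factor
  \<open>c\<close>; the state sum detects the number of boxes.\<close>

lemma (in dot_diagram) val_one_point:
  "val S (\<lambda>_. {z}) (\<lambda>_ _ _. c) F (replicate (n_in F) z) (replicate (n_out F) z) = c ^ card (boxes F)"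
proof -
  have "colourings (\<lambda>_. {z}) F = {\<lambda>d\<in>dots F. z}"
    using PiE_singleton[of "\<lambda>d\<in>dots F. z" "dots F"] unfolding colourings_def
    by (simp cong: PiE_cong)
  moreover have "ext_in F (\<lambda>d\<in>dots F. z) = replicate (n_in F) z"
    "ext_out F (\<lambda>d\<in>dots F. z) = replicate (n_out F) z"
    by (auto simp: ext_in_def ext_out_def win wout intro!: nth_equalityI)
  ultimately show ?thesis
    by (simp add: val_def weight_def)
qed

section \<open>Counting homomorphisms into part of a diagram\<close>

text \<open>Homomorphisms into the part of \<open>T\<close> with boxes \<open>B\<close> and dots
  \<open>E\<close>. The dot map comes first because, once it is fixed, the images of the boxes are
  chosen independently; this mirrors a sum over colourings of a product over boxes.\<close>

definition hom_set ::
  "('o, 'm) signature \<Rightarrow> ('o, 'm, 'b, 'd) diagram \<Rightarrow> ('o, 'm, 'c, 'e) diagram \<Rightarrow> 'c set \<Rightarrow> 'e set \<Rightarrow>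
    (('d \<Rightarrow> 'e) \<times> ('b \<Rightarrow> 'c)) set" where
  "hom_set S D T B E =
    (SIGMA x:{x \<in> colourings (\<lambda>a. {e \<in> E. dlab T e = a}) D.
        ext_in D x = ext_in T (\<lambda>e. e) \<and> ext_out D x = ext_out T (\<lambda>e. e)}.
      \<Pi>\<^sub>E b\<in>boxes D. {t \<in> B. blab T t = blab D b \<and> box_in S T (\<lambda>e. e) t = box_in S D x b \<and>
        box_out S T (\<lambda>e. e) t = box_out S D x b})"

text \<open>Boxes and dots are collected in one set, so that images can be compared within a single
  lattice of subsets.\<close>

definition hom_image ::
  "('o, 'm, 'b, 'd) diagram \<Rightarrow> ('d \<Rightarrow> 'e) \<times> ('b \<Rightarrow> 'c) \<Rightarrow> ('c + 'e) set" where
  "hom_image D h = snd h ` boxes D <+> fst h ` dots D"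

text \<open>The family \<open>N\<close> of natural-number matrices for a target. Nothing relates its
  values at \<open>f\<close> and at \<open>sdag S f\<close>, so it need not be a dagger model;
  \<open>val_nat_eq\<close> bridges this gap.\<close>

definition box_count ::
  "('o, 'm) signature \<Rightarrow> ('o, 'm, 'c, 'e) diagram \<Rightarrow> 'c set \<Rightarrow> 'm \<Rightarrow> 'e list \<Rightarrow> 'e list \<Rightarrow> nat" where
  "box_count S T B f is js =
    card {t \<in> B. blab T t = f \<and> box_in S T (\<lambda>e. e) t = is \<and> box_out S T (\<lambda>e. e) t = js}"

lemma Plus_subset_iff: "A <+> B \<subseteq> C <+> D \<longleftrightarrow> A \<subseteq> C \<and> B \<subseteq> D"
  by (auto simp: Plus_def)

lemma hom_set_subset:
  fixes D :: "('o, 'm, 'b, 'd) diagram" and T :: "('o, 'm, 'c, 'e) diagram"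
  assumes "B \<subseteq> boxes T" "E \<subseteq> dots T"
  shows "hom_set S D T B E = {h \<in> hom_set S D T (boxes T) (dots T). hom_image D h \<subseteq> B <+> E}"
proof (rule set_eqI)
  fix h :: "('d \<Rightarrow> 'e) \<times> ('b \<Rightarrow> 'c)"
  obtain x \<psi> where h: "h = (x, \<psi>)" by fastforce
  show "h \<in> hom_set S D T B E \<longleftrightarrow>
      h \<in> {h \<in> hom_set S D T (boxes T) (dots T). hom_image D h \<subseteq> B <+> E}"
    using assms unfolding h hom_set_def hom_image_def colourings_def
    by (simp add: Plus_subset_iff PiE_iff image_subset_iff) blast
qed

context dot_diagram
begin

lemma finite_hom_set:
  assumes "finite B" "finite E"
  shows "finite (hom_set S F T B E)"
proof -
  have "finite (colourings (\<lambda>a. {e \<in> E. dlab T e = a}) F)"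
    using assms finite_dots by (auto simp: colourings_def intro!: finite_PiE)
  then show ?thesis
    unfolding hom_set_def using assms finite_boxes by (auto intro!: finite_SigmaI finite_PiE)
qed

text \<open>Colouring dots by dots of \<open>T\<close> gives the dot maps, and evaluation at the
  boundary words of \<open>T\<close> itself forces external ports to be preserved. The weight is the
  product over boxes of the number of admissible images, hence the number of box maps.\<close>

lemma val_hom_set:
  assumes "finite B" "finite E"
  shows "val S (\<lambda>a. {e \<in> E. dlab T e = a}) (\<lambda>f is js. of_nat (box_count S T B f is js)) F
    (ext_in T (\<lambda>e. e)) (ext_out T (\<lambda>e. e)) =
    (of_nat (card (hom_set S F T B E)) :: 'k::comm_semiring_1)"
proof -
  let ?C = "colourings (\<lambda>a. {e \<in> E. dlab T e = a}) F"
  let ?P = "\<lambda>x. ext_in F x = ext_in T (\<lambda>e. e) \<and> ext_out F x = ext_out T (\<lambda>e. e)"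
  let ?H = "\<lambda>x. \<Pi>\<^sub>E b\<in>boxes F. {t \<in> B. blab T t = blab F b \<and> box_in S T (\<lambda>e. e) t = box_in S F x b \<and>
        box_out S T (\<lambda>e. e) t = box_out S F x b}"
  have C: "finite ?C"
    using assms finite_dots by (auto simp: colourings_def intro!: finite_PiE)
  have "weight S (\<lambda>f is js. of_nat (box_count S T B f is js)) F x =
      (of_nat (card (?H x)) :: 'k)" for x
    by (simp add: weight_def card_PiE finite_boxes box_count_def)
  then have "val S (\<lambda>a. {e \<in> E. dlab T e = a}) (\<lambda>f is js. of_nat (box_count S T B f is js)) F
    (ext_in T (\<lambda>e. e)) (ext_out T (\<lambda>e. e)) = (\<Sum>x\<in>?C. of_bool (?P x) * of_nat (card (?H x)) :: 'k)"
    by (simp add: val_def)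
  also have "\<dots> = (\<Sum>x\<in>{x \<in> ?C. ?P x}. of_nat (card (?H x)))"
    using C by (intro sum.mono_neutral_cong_right) auto
  also have "\<dots> = of_nat (card (hom_set S F T B E))"
    using C assms finite_boxes unfolding hom_set_def
    by (subst card_SigmaI) (auto intro!: finite_PiE)
  finally show ?thesis .
qed

text \<open>Equality of the words of dots around a box or along the boundary, read position by
  position, is the wiring condition.\<close>

lemma hom_set_diagram_hom:
  assumes "n_in F = n_in T" "n_out F = n_out T"
    and h: "(x, \<psi>) \<in> hom_set S F T (boxes T) (dots T)"
  shows "diagram_hom S F T \<psi> x"
proof -
  have x: "x d \<in> dots T \<and> dlab T (x d) = dlab F d" if "d \<in> dots F" for d
    using h that by (auto simp: hom_set_def colourings_def dest: PiE_mem)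
  have ext: "ext_in F x = ext_in T (\<lambda>e. e)" "ext_out F x = ext_out T (\<lambda>e. e)"
    using h by (auto simp: hom_set_def)
  have \<psi>: "\<psi> b \<in> boxes T \<and> blab T (\<psi> b) = blab F b \<and> box_in S T (\<lambda>e. e) (\<psi> b) = box_in S F x b \<and>
      box_out S T (\<lambda>e. e) (\<psi> b) = box_out S F x b" if "b \<in> boxes F" for b
    using h that by (auto simp: hom_set_def dest: PiE_mem)
  show ?thesis
  proof
    show "n_in F = n_in T" "n_out F = n_out T" by fact+
    show "win T (Ext i) = x (win F (Ext i))" if "i < n_in F" for i
      using arg_cong[OF ext(1), of "\<lambda>l. l ! i"] that assms by (simp add: ext_in_def)
    show "wout T (Ext i) = x (wout F (Ext i))" if "i < n_out F" for i
      using arg_cong[OF ext(2), of "\<lambda>l. l ! i"] that assms by (simp add: ext_out_def)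
    show "win T (Box (\<psi> b) i) = x (win F (Box b i))"
      if "b \<in> boxes F" "i < length (sdom S (blab F b))" for b i
    proof -
      have "blab T (\<psi> b) = blab F b" "box_in S T (\<lambda>e. e) (\<psi> b) = box_in S F x b"
        using \<psi>[OF that(1)] by auto
      then show ?thesis
        using that(2) by (simp add: box_in_def)
    qed
    show "wout T (Box (\<psi> b) i) = x (wout F (Box b i))"
      if "b \<in> boxes F" "i < length (scod S (blab F b))" for b i
    proof -
      have "blab T (\<psi> b) = blab F b" "box_out S T (\<lambda>e. e) (\<psi> b) = box_out S F x b"
        using \<psi>[OF that(1)] by auto
      then show ?thesis
        using that(2) by (simp add: box_out_def)
    qed
  qed (use x \<psi> in auto)
qed

lemma diagram_hom_hom_set:
  assumes "diagram_hom S F T b d"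
  shows "(restrict d (dots F), restrict b (boxes F)) \<in> hom_set S F T (boxes T) (dots T)"
proof -
  interpret FT: diagram_hom S F T b d by fact
  have "restrict d (dots F) \<in> colourings (\<lambda>a. {e \<in> dots T. dlab T e = a}) F"
    by (auto simp: colourings_def FT.dots FT.dlab)
  moreover have "ext_in F (restrict d (dots F)) = ext_in T (\<lambda>e. e)"
    "ext_out F (restrict d (dots F)) = ext_out T (\<lambda>e. e)"
    by (auto simp: ext_in_def ext_out_def FT.win_Ext FT.wout_Ext win wout
        simp flip: FT.n_in FT.n_out)
  moreover have "box_in S T (\<lambda>e. e) (b c) = box_in S F (restrict d (dots F)) c"
    "box_out S T (\<lambda>e. e) (b c) = box_out S F (restrict d (dots F)) c" if "c \<in> boxes F" for c
    using that by (auto simp: box_in_def box_out_def FT.win_Box FT.wout_Box FT.blab win wout)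
  ultimately show ?thesis
    by (simp add: hom_set_def FT.boxes FT.blab)
qed

end

text \<open>Inversion over the lattice of subsets: counts of images inside each \<open>U\<close>
  determine counts of images equal to \<open>U\<close>, by induction on \<open>U\<close> after
  subtracting the proper subsets.\<close>

lemma card_fibres_eq:
  fixes s :: "'a \<Rightarrow> 'u set" and t :: "'b \<Rightarrow> 'u set"
  assumes A: "finite A" and B: "finite B" and W: "finite W"
    and eq: "\<And>U. U \<subseteq> W \<Longrightarrow> card {a \<in> A. s a \<subseteq> U} = card {b \<in> B. t b \<subseteq> U}"
    and "U \<subseteq> W"
  shows "card {a \<in> A. s a = U} = card {b \<in> B. t b = U}"
proof -
  have "finite U"
    using \<open>U \<subseteq> W\<close> W by (rule finite_subset)
  then show ?thesis
    using \<open>U \<subseteq> W\<close>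
  proof (induction U rule: finite_psubset_induct)
    case (psubset U)
    have split: "card {c \<in> C. r c \<subseteq> U} = card {c \<in> C. r c = U} + (\<Sum>V\<in>{V. V \<subset> U}. card {c \<in> C. r c = V})"
      if "finite C" for C :: "'z set" and r
    proof -
      have eq: "{c \<in> C. r c \<subseteq> U} = {c \<in> C. r c = U} \<union> (\<Union>V\<in>{V. V \<subset> U}. {c \<in> C. r c = V})"
        by auto
      have "finite (\<Union>V\<in>{V. V \<subset> U}. {c \<in> C. r c = V})"
        by (rule finite_subset[OF _ that]) auto
      then have "card {c \<in> C. r c \<subseteq> U}
          = card {c \<in> C. r c = U} + card (\<Union>V\<in>{V. V \<subset> U}. {c \<in> C. r c = V})"
        unfolding eq using that by (intro card_Un_disjoint) auto
      also have "card (\<Union>V\<in>{V. V \<subset> U}. {c \<in> C. r c = V}) = (\<Sum>V\<in>{V. V \<subset> U}. card {c \<in> C. r c = V})"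
        using that psubset.hyps
        by (intro card_UN_disjoint) (auto intro: finite_subset[of _ "Pow U"])
      finally show ?thesis .
    qed
    have "(\<Sum>V\<in>{V. V \<subset> U}. card {a \<in> A. s a = V}) = (\<Sum>V\<in>{V. V \<subset> U}. card {b \<in> B. t b = V})"
      using psubset by (intro sum.cong) auto
    then show ?case
      using split[OF A, of s] split[OF B, of t] eq[OF psubset.prems] by linarith
  qed
qed

section \<open>Diagrams that no model separates\<close>

text \<open>The assumptions are symmetric in \<open>F\<close> and \<open>G\<close>, so the results
  can be used in both orders. The parameter \<open>atoms\<close> fixes the type \<open>'i\<close>,
  which the types of the other parameters do not mention.\<close>

locale indistinguishable = dagger_signature S + nontrivial_involution bar
  + F: dot_diagram S F + G: dot_diagram S G
  for S :: "('o, 'm) signature" and bar :: "'k::field_char_0 \<Rightarrow> 'k"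
    and F :: "('o, 'm, 'b, 'd) diagram" and G :: "('o, 'm, 'c, 'e) diagram" +
  fixes atoms :: "'i itself"
  assumes dims: "n_in F = n_in G" "n_out F = n_out G"
    and val_eq: "\<And>(X :: 'o \<Rightarrow> 'i elt set) M is js. dagger_model S bar X M \<Longrightarrow>
      val S X M F is js = val S X M G is js"
begin

lemma bar_of_nat: "bar (of_nat n) = of_nat n"
proof (induction n)
  case 0
  show ?case using bar_add[of 0 0] by (metis add_cancel_right_left of_nat_0)
qed (simp add: bar_add bar_one)

lemma bar_uminus: "bar (- x) = - bar x"
  using bar_add[of "- x" x] bar_of_nat[of 0] by (simp add: eq_neg_iff_add_eq_0)

lemma bar_diff: "bar (x - y) = bar x - bar y"
  using bar_add[of x "- y"] by (simp add: bar_uminus)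

lemma dagger_modelI:
  assumes "\<And>a. finite (X a)" "\<And>f is js. f \<in> Mor S \<Longrightarrow> M (sdag S f) js is = bar (M f is js)"
  shows "dagger_model S bar X M"
  by unfold_locales (use assms in auto)

text \<open>The constant matrix 2 on a one-point set is a dagger model, as \<open>bar\<close> fixes
  2; in characteristic 0 the resulting power of 2 determines its exponent.\<close>

lemma card_boxes: "card (boxes F) = card (boxes G)"
proof -
  have "bar 2 = 2"
    using bar_of_nat[of 2] by simp
  then have "dagger_model S bar (\<lambda>_. {Star :: 'i elt}) (\<lambda>_ _ _. 2)"
    by (intro dagger_modelI) auto
  from val_eq[OF this] have "(2 :: 'k) ^ card (boxes F) = 2 ^ card (boxes G)"
    using F.val_one_point[of "Star :: 'i elt" "2 :: 'k"] G.val_one_point[of "Star :: 'i elt" "2 :: 'k"]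
    by (simp add: dims)
  then have "of_nat (2 ^ card (boxes F)) = (of_nat (2 ^ card (boxes G)) :: 'k)"
    by simp
  then show ?thesis
    unfolding of_nat_eq_iff by simp
qed

text \<open>Removes the dagger condition for matrices of natural numbers. Dagger models exist for
  infinitely many values of a parameter, and a polynomial identity carries the equality to a value
  where the model is a multiple of \<open>N\<close>.\<close>

lemma val_nat_eq:
  fixes N :: "'m \<Rightarrow> 'i elt list \<Rightarrow> 'i elt list \<Rightarrow> nat" and X :: "'o \<Rightarrow> 'i elt set"
  assumes X: "\<And>a. finite (X a)"
  shows "val S X (\<lambda>f is js. of_nat (N f is js) :: 'k) F is js =
    val S X (\<lambda>f is js. of_nat (N f is js)) G is js"
proof -
  obtain k where "bar k \<noteq> k"
    using bar_nontrivial by (auto simp: fun_eq_iff)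
  \<comment> \<open>An element that \<open>bar\<close> negates; it is nonzero because
    \<open>bar\<close> moves \<open>k\<close>.\<close>
  define \<omega> where "\<omega> = k - bar k"
  have \<omega>: "\<omega> \<noteq> 0" "bar \<omega> = - \<omega>"
    using \<open>bar k \<noteq> k\<close> bar_add[of k "- bar k"] by (auto simp: \<omega>_def bar_uminus bar_bar)
  \<comment> \<open>The parameter is the polynomial variable. At a natural number \<open>n\<close>,
    \<open>bar\<close> exchanges \<open>n + \<omega>\<close> and \<open>n - \<omega>\<close>, while
    passing to \<open>sdag S f\<close> exchanges the two summands; together this is the dagger
    condition.\<close>
  define M where "M f is js = smult (of_nat (N f is js)) [:\<omega>, 1:]
    + smult (of_nat (N (sdag S f) js is)) [:- \<omega>, 1:]" for f "is" js
  define P where "P = val S X M F is js - val S X M G is js"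
  have "dagger_model S bar X (\<lambda>f is js. poly (M f is js) (of_nat n))" for n
    by (intro dagger_modelI X)
      (simp add: M_def bar_add bar_mult bar_of_nat bar_uminus bar_diff \<omega> sdag_sdag algebra_simps)
  then have "poly P (of_nat n) = 0" for n
    by (simp add: P_def poly_val val_eq)
  then have "range of_nat \<subseteq> {x. poly P x = 0}"
    by auto
  moreover have "infinite (range (of_nat :: nat \<Rightarrow> 'k))"
    by (rule range_inj_infinite) (simp add: inj_of_nat)
  \<comment> \<open>In characteristic 0 the natural numbers supply infinitely many roots.\<close>
  ultimately have "P = 0"
    using poly_roots_finite[of P] finite_subset by blast
  \<comment> \<open>At \<open>\<omega>\<close> the transposed term vanishes. Each box then
    contributes a factor \<open>2 * \<omega>\<close>; the two powers are equal by
    \<open>card_boxes\<close> and nonzero, so they cancel.\<close>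
  have "poly (M f is js) \<omega> = (2 * \<omega>) * of_nat (N f is js)" for f "is" js
    by (simp add: M_def algebra_simps)
  then have "poly P \<omega> = (2 * \<omega>) ^ card (boxes F) * val S X (\<lambda>f is js. of_nat (N f is js)) F is js
      - (2 * \<omega>) ^ card (boxes G) * val S X (\<lambda>f is js. of_nat (N f is js)) G is js"
    by (simp add: P_def poly_val val_scale)
  then show ?thesis
    using \<open>P = 0\<close> \<omega> card_boxes by simp
qed

text \<open>The equality of state sums holds in the field and descends to natural numbers in
  characteristic 0. The dots of \<open>T\<close> lie in \<open>'i elt\<close> because they serve as
  colours.\<close>

lemma card_hom_set_eq:
  fixes T :: "('o, 'm, 't, 'i elt) diagram"
  assumes "finite B" "finite E"
  shows "card (hom_set S F T B E) = card (hom_set S G T B E)"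
proof -
  have "of_nat (card (hom_set S F T B E)) = (of_nat (card (hom_set S G T B E)) :: 'k)"
    unfolding F.val_hom_set[OF assms, symmetric] G.val_hom_set[OF assms, symmetric]
    using assms by (intro val_nat_eq) simp
  then show ?thesis
    by simp
qed

text \<open>The counts agree for every part of \<open>T\<close>, so by \<open>card_fibres_eq\<close>
  they agree for homomorphisms with full image. The given one makes this number nonzero for
  \<open>F\<close>, hence for \<open>G\<close>.\<close>

lemma surjective_hom:
  fixes T :: "('o, 'm, 't, 'i elt) diagram"
  assumes T: "dot_diagram S T" and "n_in F = n_in T" "n_out F = n_out T"
    and h: "diagram_hom S F T b d" "b ` boxes F = boxes T" "d ` dots F = dots T"
  shows "\<exists>b' d'. diagram_hom S G T b' d' \<and> b' ` boxes G = boxes T \<and> d' ` dots G = dots T"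
proof -
  interpret T: dot_diagram S T by fact
  let ?W = "boxes T <+> dots T"
  let ?A = "hom_set S F T (boxes T) (dots T)" and ?B = "hom_set S G T (boxes T) (dots T)"
  have fin: "finite ?A" "finite ?B"
    by (simp_all add: F.finite_hom_set G.finite_hom_set T.finite_boxes T.finite_dots)
  have "card {h \<in> ?A. hom_image F h = ?W} = card {h \<in> ?B. hom_image G h = ?W}"
  proof (rule card_fibres_eq[OF fin])
    fix U assume "U \<subseteq> ?W"
    \<comment> \<open>Every subset of the disjoint union is a set of boxes together with a set of
      dots, that is, a part to which \<open>card_hom_set_eq\<close> applies.\<close>
    then obtain B E where U: "U = B <+> E" "B \<subseteq> boxes T" "E \<subseteq> dots T"
      by (intro that[of "Inl -` U" "Inr -` U"]) (auto simp: Plus_def)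
    then show "card {h \<in> ?A. hom_image F h \<subseteq> U} = card {h \<in> ?B. hom_image G h \<subseteq> U}"
      using card_hom_set_eq[of B E T] T.finite_boxes T.finite_dots
      by (simp add: hom_set_subset[symmetric] finite_subset)
  qed (simp_all add: T.finite_boxes T.finite_dots)
  moreover have "(restrict d (dots F), restrict b (boxes F)) \<in> {h \<in> ?A. hom_image F h = ?W}"
    using F.diagram_hom_hom_set[OF h(1)] h(2,3) by (simp add: hom_image_def)
  then have "card {h \<in> ?A. hom_image F h = ?W} \<noteq> 0"
    using fin by (auto simp: card_eq_0_iff)
  ultimately obtain x \<psi> where "(x, \<psi>) \<in> ?B" "hom_image G (x, \<psi>) = ?W"
    by (metis (mono_tags, lifting) card.empty equals0I mem_Collect_eq surj_pair)
  then show ?thesis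
    using G.hom_set_diagram_hom[of T x \<psi>] assms(2,3) dims
    by (auto simp: hom_image_def set_eq_subset Plus_subset_iff)
qed

text \<open>The target is a copy of \<open>F\<close> itself with dots in \<open>'i elt\<close>; the
  isomorphism from \<open>F\<close> is surjective, so \<open>G\<close> also has a surjective
  homomorphism onto the copy.\<close>

lemma surjective_hom_onto_copy:
  obtains T :: "('o, 'm, nat, 'i elt) diagram" and b d where "dot_diagram S T" "diagram_iso S F T"
    "diagram_hom S G T b d" "b ` boxes G = boxes T" "d ` dots G = dots T"
proof -
  obtain T :: "('o, 'm, nat, 'i elt) diagram" where T: "dot_diagram S T" "diagram_iso S F T"
    using diagram_relabel[OF F.dot_diagram_axioms infinite_UNIV_nat infinite_UNIV_elt] .
  from T(2) obtain b d where h: "diagram_hom S F T b d" "bij_betw b (boxes F) (boxes T)"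
    "bij_betw d (dots F) (dots T)"
    by (rule diagram_iso_bijE)
  moreover have "n_in F = n_in T" "n_out F = n_out T"
    using h(1) by (simp_all add: diagram_hom_def)
  ultimately show ?thesis
    using surjective_hom[OF T(1)] T that by (metis bij_betw_imp_surj_on)
qed

lemma card_dots_le: "card (dots F) \<le> card (dots G)"
proof -
  obtain T :: "('o, 'm, nat, 'i elt) diagram" and d where "diagram_iso S F T" "d ` dots G = dots T"
    by (rule surjective_hom_onto_copy)
  then show ?thesis
    by (metis G.finite_dots bij_betw_same_card card_image_le diagram_iso_bijE)
qed

text \<open>A surjection between finite sets of equal size is bijective, so the homomorphism from
  \<open>G\<close> onto the copy of \<open>F\<close> is an isomorphism; for boxes the sizes agree by
  \<open>card_boxes\<close>.\<close>

lemma iso_if_card_dots_eq: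
  assumes "card (dots F) = card (dots G)"
  shows "diagram_iso S F G"
proof -
  obtain T :: "('o, 'm, nat, 'i elt) diagram" and b d where T: "dot_diagram S T" "diagram_iso S F T"
    and h: "diagram_hom S G T b d" "b ` boxes G = boxes T" "d ` dots G = dots T"
    by (rule surjective_hom_onto_copy)
  from T(2) obtain b' d' where "bij_betw b' (boxes F) (boxes T)" "bij_betw d' (dots F) (dots T)"
    by (rule diagram_iso_bijE)
  then have "card (boxes T) = card (boxes G)" "card (dots T) = card (dots G)"
    using assms card_boxes by (metis bij_betw_same_card)+
  then have "diagram_iso S G T"
    using h G.finite_boxes G.finite_dots
    by (intro diagram_isoI[OF G.dot_diagram_axioms h(1)]) (auto simp: bij_betw_def eq_card_imp_inj_on)
  then show ?thesis
    using diagram_iso_trans[OF F.dot_diagram_axioms T(2)] diagram_iso_sym by blast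
qed

end

theorem theorem7p1:
  fixes bar :: "'k::field_char_0 \<Rightarrow> 'k"
    and S :: "('o, 'm) signature"
    and F :: "('o, 'm, 'b, 'd) diagram"
    and G :: "('o, 'm, 'c, 'e) diagram"
  assumes "nontrivial_involution bar"
    and "dagger_signature S"
    and "dot_diagram S F"
    and "dot_diagram S G"
    and "diag_dom F = diag_dom G"
    and "diag_cod F = diag_cod G"
  shows "diagram_iso S F G \<longleftrightarrow>
    (\<forall>H :: ('o list, ('o, 'm) dot_class, 'i elt set, ('i, 'k) matrix) functor_data.
       dagger_hypergraph_functor (Dot S) (Mat bar) H \<longrightarrow> FM H (dcls S F) = FM H (dcls S G))"
    (is "_ \<longleftrightarrow> ?agree")
proof
  assume "diagram_iso S F G"
  then show ?agree
    by (simp add: dcls_eq)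
next
  assume agree: ?agree
  have dims: "n_in F = n_in G" "n_out F = n_out G"
    using assms(5,6) by (metis length_diag_dom, metis length_diag_cod)
  \<comment> \<open>Each dagger model yields a functor, to which the agreement assumption
    applies.\<close>
  have val: "val S X M F is js = val S X M G is js" if "dagger_model S bar X M"
    for X :: "'o \<Rightarrow> 'i elt set" and M "is" js
  proof -
    interpret dagger_model S bar X M by fact
    show ?thesis
      using assms agree model_functor by (intro model_functor_dcls) auto
  qed
  interpret FG: indistinguishable S bar F G "TYPE('i)"
    using assms dims val by (simp add: indistinguishable_def indistinguishable_axioms_def)
  \<comment> \<open>The reversed order gives the opposite inequality between the numbers of
    dots.\<close>
  interpret GF: indistinguishable S bar G F "TYPE('i)"
    using assms dims val by (simp add: indistinguishable_def indistinguishable_axioms_def)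
  show "diagram_iso S F G"
    using FG.card_dots_le GF.card_dots_le by (intro FG.iso_if_card_dots_eq) simp
qed

end
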